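(* Let $n\ge 1$. In the Hecke algebra $H_n=R_n^n(v,s)$ (with $z=s-s^{-1}$ invertible), the sum of the Murphy operators $M=\sum_{j=2}^n M(j)=\sum_{1\le i<j\le n}\omega_{(i\,j)}$ is represented, up to linear combination with the identity, by the single tangle $T^{(n)}$; that is, $M$ is a linear combination, with scalar coefficients, of $T^{(n)}$ and the identity element $1\in H_n$.
   Context: Coefficients: $\Lambda$ is $\mathbf{Z}[v^{\pm1},s^{\pm1}]$ with all $s^k-s^{-k}$ ($k\ge1$) inverted, and $z=s-s^{-1}$. Homfly skein: for a planar surface $F$ with designated input and output boundary points, $\mathcal{S}(F)$ is the $\Lambda$-module of linear combinations of oriented tangle diagrams in $F$ (arcs from inputs to outputs, and closed curves), considered up to isotopy fixing the boundary and Reidemeister moves II and III, modulo the local relations $X_+-X_-=z\,X_0$ (positive crossing minus negative crossing equals $z$ times the oriented smoothing) and (strand with one positive kink) $=v^{-1}\cdot$(strand). A disjoint null-homotopic simple loop contributes the scalar $\delta=(v^{-1}-v)/z$. Hecke algebra: $R_n^n=R_n^n(v,s)$ is the skein of a rectangle with $n$ inputs at the bottom and $n$ outputs at the top, an algebra under composition (stacking) of tangles. It is isomorphic to the Hecke algebra $H_n$ with generators $\sigma_1,\dots,\sigma_{n-1}$, braid relations, and $\sigma_i^2=z\sigma_i+1$, where $\sigma_i$ is the elementary braid with one positive crossing between strings $i$ and $i+1$. We write $H_n$ for $R_n^n$. Murphy operators: for a permutation $\pi\in S_n$, $\omega_\pi$ is the corresponding positive permutation braid (the product of generators $\sigma_i$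 along any reduced word for $\pi$). In particular, for $i<j$, $\omega_{(i\,j)}=\sigma_{j-1}\cdots\sigma_{i+1}\sigma_i\sigma_{i+1}\cdots\sigma_{j-1}$. The Murphy operator is $M(j)=\sum_{i=1}^{j-1}\omega_{(i\,j)}$, $2\le j\le n$. The tangle $T^{(n)}$: it consists of the identity braid on $n$ vertical strings oriented upwards, together with one simple closed loop encircling all $n$ strings. The loop crosses each string exactly twice, passing in front of all the strings along one horizontal arc and behind all the strings along the other, and is oriented so that all $2n$ crossings are positive. *)

theory Defs
  imports
    "HOL-Library.Poly_Mapping"
    "HOL-Computational_Algebra.Polynomial"
    "HOL-Computational_Algebra.Fraction_Field"
    "HOL-Combinatorics.Transposition"
    "HOL-Algebra.QuotRing"
    "HOL-Algebra.Module"
begin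

section \<open>The coefficient ring\<close>

text \<open>
  The ring \<open>\<Lambda>\<close> is realised inside the field of fractions of \<open>\<int>[s][v]\<close>, as the smallest subring
  containing \<open>v\<close>, \<open>s\<close>, their inverses and the inverses of all \<open>s\<^sup>k - s\<^sup>-\<^sup>k\<close> with \<open>k \<ge> 1\<close>.
\<close>

definition frac_v :: "int poly poly fract" where
  "frac_v = Fract [:0, 1:] 1"

definition frac_s :: "int poly poly fract" where
  "frac_s = Fract [:[:0, 1:]:] 1"

inductive_set coeff_set :: "int poly poly fract set" where
  zero: "0 \<in> coeff_set"
| one: "1 \<in> coeff_set"
| v: "frac_v \<in> coeff_set"
| v_inv: "inverse frac_v \<in> coeff_set"
| s: "frac_s \<in> coeff_set"
| s_inv: "inverse frac_s \<in> coeff_set"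
| s_diff_inv: "k \<ge> 1 \<Longrightarrow> inverse (frac_s ^ k - inverse frac_s ^ k) \<in> coeff_set"
| add: "x \<in> coeff_set \<Longrightarrow> y \<in> coeff_set \<Longrightarrow> x + y \<in> coeff_set"
| uminus: "x \<in> coeff_set \<Longrightarrow> - x \<in> coeff_set"
| mult: "x \<in> coeff_set \<Longrightarrow> y \<in> coeff_set \<Longrightarrow> x * y \<in> coeff_set"

typedef coeff = coeff_set
  by (rule exI[of _ 0]) (rule coeff_set.zero)

setup_lifting type_definition_coeff

instantiation coeff :: idom
begin

lift_definition zero_coeff :: coeff is 0 by (rule coeff_set.zero)
lift_definition one_coeff :: coeff is 1 by (rule coeff_set.one)
lift_definition plus_coeff :: "coeff \<Rightarrow> coeff \<Rightarrow> coeff" is "(+)" by (rule coeff_set.add)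
lift_definition uminus_coeff :: "coeff \<Rightarrow> coeff" is uminus by (rule coeff_set.uminus)
lift_definition minus_coeff :: "coeff \<Rightarrow> coeff \<Rightarrow> coeff" is "(-)"
  using coeff_set.add coeff_set.uminus by (metis diff_conv_add_uminus)
lift_definition times_coeff :: "coeff \<Rightarrow> coeff \<Rightarrow> coeff" is "(*)" by (rule coeff_set.mult)

instance
  by intro_classes (transfer; simp add: algebra_simps)+

end

lift_definition coeff_v :: coeff is frac_v by (rule coeff_set.v)
lift_definition coeff_v_inv :: coeff is "inverse frac_v" by (rule coeff_set.v_inv)
lift_definition coeff_s :: coeff is frac_s by (rule coeff_set.s)
lift_definition coeff_s_inv :: coeff is "inverse frac_s" by (rule coeff_set.s_inv)

definition coeff_z :: coeff where
  "coeff_z = coeff_s - coeff_s_inv"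

lift_definition coeff_z_inv :: coeff is "inverse (frac_s - inverse frac_s)"
  using coeff_set.s_diff_inv[of 1] by simp

definition coeff_delta :: coeff where
  "coeff_delta = (coeff_v_inv - coeff_v) * coeff_z_inv"

lemma frac_v_nonzero: "frac_v \<noteq> 0"
  by (simp add: frac_v_def Zero_fract_def eq_fract)

lemma frac_s_nonzero: "frac_s \<noteq> 0"
  by (simp add: frac_s_def Zero_fract_def eq_fract)

lemma frac_s_power: "frac_s ^ k = Fract [:[:0, 1:] ^ k:] 1"
  by (induction k) (simp_all add: frac_s_def One_fract_def one_pCons)

lemma frac_s_diff_nonzero:
  assumes "k \<ge> 1"
  shows "frac_s ^ k - inverse frac_s ^ k \<noteq> 0"
proof
  assume "frac_s ^ k - inverse frac_s ^ k = 0"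
  then have "frac_s ^ k * frac_s ^ k = 1"
    using frac_s_nonzero by (simp add: power_inverse field_simps)
  then have "frac_s ^ (k + k) = 1"
    by (simp add: power_add)
  then have "[:0, 1::int:] ^ (k + k) = 1"
    unfolding frac_s_power by (simp add: One_fract_def eq_fract one_pCons)
  then have "degree ([:0, 1::int:] ^ (k + k)) = 0"
    by simp
  then show False
    using assms by (simp add: degree_power_eq)
qed

lemma coeff_v_unit: "coeff_v * coeff_v_inv = 1"
  by transfer (simp add: frac_v_nonzero)

lemma coeff_s_unit: "coeff_s * coeff_s_inv = 1"
  by transfer (simp add: frac_s_nonzero)

lemma coeff_z_unit: "coeff_z * coeff_z_inv = 1"
  unfolding coeff_z_def by transfer (use frac_s_diff_nonzero[of 1] in simp)


section \<open>Oriented tangle diagrams in a rectangle\<close>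

text \<open>
  A diagram in general position with respect to the height function is cut by horizontal lines
  into layers, each containing a single crossing, minimum (cup) or maximum (cap) between vertical
  strands; a diagram is the list of its layers, read from bottom to top.  The level sets between
  consecutive layers are recorded as lists of strand directions, read from left to right.
\<close>

datatype dir = Up | Down

primrec rev_dir :: "dir \<Rightarrow> dir" where
  "rev_dir Up = Down"
| "rev_dir Down = Up"

text \<open>
  \<open>Cross h d e\<close> is a crossing of a strand with direction \<open>d\<close>, joining bottom left to top right, and a
  strand with direction \<open>e\<close>, joining bottom right to top left; \<open>h\<close> tells whether the strand joining
  bottom left to top right passes over or under the other one.  \<open>Cup d\<close> and \<open>Cap d\<close> have their left
  end directed by \<open>d\<close>.
\<close>

datatype height = Over | Under

primrec flip :: "height \<Rightarrow> height" where
  "flip Over = Under"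
| "flip Under = Over"

datatype piece = Cross height dir dir | Cup dir | Cap dir

primrec piece_bot :: "piece \<Rightarrow> dir list" where
  "piece_bot (Cross h d e) = [d, e]"
| "piece_bot (Cup d) = []"
| "piece_bot (Cap d) = [d, rev_dir d]"

primrec piece_top :: "piece \<Rightarrow> dir list" where
  "piece_top (Cross h d e) = [e, d]"
| "piece_top (Cup d) = [d, rev_dir d]"
| "piece_top (Cap d) = []"

text \<open>
  The sign of a crossing.  A crossing of two upward strands is positive if the strand joining bottom
  left to top right is the overpass; reversing one strand changes the sign.
\<close>

definition pos_height :: "dir \<Rightarrow> dir \<Rightarrow> height" where
  "pos_height d e = (if d = e then Over else Under)"

abbreviation pos_cross :: "dir \<Rightarrow> dir \<Rightarrow> piece" where
  "pos_cross d e \<equiv> Cross (pos_height d e) d e"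

abbreviation neg_cross :: "dir \<Rightarrow> dir \<Rightarrow> piece" where
  "neg_cross d e \<equiv> Cross (flip (pos_height d e)) d e"

text \<open>A layer: the vertical strands to the left, the piece, the vertical strands to the right.\<close>

type_synonym layer = "dir list \<times> piece \<times> dir list"
type_synonym tangle = "layer list"

fun is_tangle :: "dir list \<Rightarrow> tangle \<Rightarrow> dir list \<Rightarrow> bool" where
  "is_tangle a [] b \<longleftrightarrow> a = b"
| "is_tangle a ((l, p, r) # t) b \<longleftrightarrow>
     a = l @ piece_bot p @ r \<and> is_tangle (l @ piece_top p @ r) t b"

definition tangles :: "dir list \<Rightarrow> dir list \<Rightarrow> tangle set" where
  "tangles a b = {t. is_tangle a t b}"

text \<open>The oriented smoothing of a crossing with directions \<open>d\<close> and \<open>e\<close>.\<close>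

definition smoothing :: "dir \<Rightarrow> dir \<Rightarrow> tangle" where
  "smoothing d e = (if d = e then [] else [([], Cap d, []), ([], Cup e, [])])"

text \<open>
  The first five rules generate planar isotopy of layered diagrams: exchanging the heights of two
  pieces lying side by side (with strands \<open>m\<close> between them), creating or cancelling a
  maximum-minimum pair on a strand, and moving a maximum or minimum of a strand past a crossing
  with another strand.  In \<open>reid3\<close> the side condition excludes the two cyclic choices of crossings,
  for which the three strands cannot lie above one another.
\<close>

inductive diagram_move :: "tangle \<Rightarrow> tangle \<Rightarrow> bool" where
  exchange: "diagram_move
     [([], p, m @ piece_bot q), (piece_top p @ m, q, [])]
     [(piece_bot p @ m, q, []), ([], p, m @ piece_top q)]"
| zigzag_right: "diagram_move [([d], Cup (rev_dir d), []), ([], Cap d, [d])] []"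
| zigzag_left: "diagram_move [([], Cup d, [d]), ([d], Cap (rev_dir d), [])] []"
| cap_slide: "diagram_move
     [([], Cross h d e, [rev_dir d]), ([e], Cap d, [])]
     [([d], Cross (flip h) e (rev_dir d), []), ([], Cap d, [e])]"
| cup_slide: "diagram_move
     [([e], Cup d, []), ([], Cross h e d, [rev_dir d])]
     [([], Cup d, [e]), ([d], Cross (flip h) (rev_dir d) e, [])]"
| reid2: "diagram_move [([], Cross h d e, []), ([], Cross (flip h) e d, [])] []"
| reid3: "\<not> (h1 = h3 \<and> h2 \<noteq> h1) \<Longrightarrow> diagram_move
     [([], Cross h1 d e, [f]), ([e], Cross h2 d f, []), ([], Cross h3 e f, [d])]
     [([d], Cross h3 e f, []), ([], Cross h2 d f, [e]), ([f], Cross h1 d e, [])]"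

text \<open>A strand directed by \<open>d\<close> with a positive curl on its right or on its left.\<close>

definition curl_right :: "dir \<Rightarrow> tangle" where
  "curl_right d = [([d], Cup d, []), ([], pos_cross d d, [rev_dir d]), ([d], Cap d, [])]"

definition curl_left :: "dir \<Rightarrow> tangle" where
  "curl_left d =
     [([], Cup (rev_dir d), [d]), ([rev_dir d], pos_cross d d, []), ([], Cap (rev_dir d), [d])]"

definition loop :: "dir \<Rightarrow> tangle" where
  "loop d = [([], Cup d, []), ([], Cap d, [])]"


section \<open>The Homfly skein of a rectangle\<close>

text \<open>
  The diagram containing \<open>t\<close> in a small rectangle, with vertical strands \<open>l\<close> and \<open>r\<close> at its sides,
  \<open>u\<close> below and \<open>w\<close> above.
\<close>

definition plug :: "tangle \<Rightarrow> dir list \<Rightarrow> dir list \<Rightarrow> tangle \<Rightarrow> tangle \<Rightarrow> tangle" where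
  "plug u l r w t = u @ map (\<lambda>(a, p, b). (l @ a, p, b @ r)) t @ w"

abbreviation diag :: "tangle \<Rightarrow> tangle \<Rightarrow>\<^sub>0 coeff" where
  "diag t \<equiv> Poly_Mapping.single t 1"

definition scale :: "coeff \<Rightarrow> (tangle \<Rightarrow>\<^sub>0 coeff) \<Rightarrow> (tangle \<Rightarrow>\<^sub>0 coeff)" where
  "scale c x = Poly_Mapping.map ((*) c) x"

text \<open>
  The submodule of the free module on the diagrams with bottom \<open>a\<close> and top \<open>b\<close> that is spanned by
  the local relations.
\<close>

inductive_set skein_relations :: "dir list \<Rightarrow> dir list \<Rightarrow> (tangle \<Rightarrow>\<^sub>0 coeff) set"
  for a b :: "dir list" where
  zero: "0 \<in> skein_relations a b"
| add: "x \<in> skein_relations a b \<Longrightarrow> y \<in> skein_relations a b \<Longrightarrow> x + y \<in> skein_relations a b"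
| scale: "x \<in> skein_relations a b \<Longrightarrow> scale c x \<in> skein_relations a b"
| move: "diagram_move t t' \<Longrightarrow> C = plug u l r w \<Longrightarrow> {C t, C t'} \<subseteq> tangles a b \<Longrightarrow>
    diag (C t) - diag (C t') \<in> skein_relations a b"
| skein: "C = plug u l r w \<Longrightarrow>
    {C [([], pos_cross d e, [])], C [([], neg_cross d e, [])], C (smoothing d e)} \<subseteq> tangles a b \<Longrightarrow>
    diag (C [([], pos_cross d e, [])]) - diag (C [([], neg_cross d e, [])])
      - scale coeff_z (diag (C (smoothing d e))) \<in> skein_relations a b"
| kink: "t \<in> {curl_right d, curl_left d} \<Longrightarrow> C = plug u l r w \<Longrightarrow> {C t, C []} \<subseteq> tangles a b \<Longrightarrow>
    diag (C t) - scale coeff_v_inv (diag (C [])) \<in> skein_relations a b"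
| loop: "C = plug u l r w \<Longrightarrow> {C (loop d), C []} \<subseteq> tangles a b \<Longrightarrow>
    diag (C (loop d)) - scale coeff_delta (diag (C [])) \<in> skein_relations a b"

text \<open>
  With concatenation as addition of lists, the convolution product of finitely supported functions
  is the bilinear extension of stacking (the second factor on top of the first).
\<close>

instantiation list :: (type) monoid_add
begin

definition zero_list :: "'a list" where "zero_list = []"
definition plus_list :: "'a list \<Rightarrow> 'a list \<Rightarrow> 'a list" where "plus_list xs ys = xs @ ys"

instance
  by intro_classes (simp_all add: zero_list_def plus_list_def)

end

abbreviation ups :: "nat \<Rightarrow> dir list" where
  "ups n \<equiv> replicate n Up"

definition tangle_algebra :: "nat \<Rightarrow> (coeff, tangle \<Rightarrow>\<^sub>0 coeff) module" where
  "tangle_algebra n =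
     \<lparr>carrier = {x. Poly_Mapping.keys x \<subseteq> tangles (ups n) (ups n)}, mult = (*), one = 1, zero = 0, add = (+),
      smult = scale\<rparr>"

definition hecke_rels :: "nat \<Rightarrow> (tangle \<Rightarrow>\<^sub>0 coeff) set" where
  "hecke_rels n = skein_relations (ups n) (ups n)"

text \<open>The algebra \<open>R\<^sub>n\<^sup>n\<close>: the library's quotient ring, together with the scalar multiplication.\<close>

definition hecke :: "nat \<Rightarrow> (coeff, (tangle \<Rightarrow>\<^sub>0 coeff) set) module" where
  "hecke n = ring.extend (tangle_algebra n Quot hecke_rels n)
     (module.fields (\<lambda>c X. \<Union>x\<in>X. hecke_rels n +>\<^bsub>tangle_algebra n\<^esub> (c \<odot>\<^bsub>tangle_algebra n\<^esub> x)))"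

definition tangle_class :: "nat \<Rightarrow> tangle \<Rightarrow> (tangle \<Rightarrow>\<^sub>0 coeff) set" where
  "tangle_class n t = hecke_rels n +>\<^bsub>tangle_algebra n\<^esub> diag t"


section \<open>Murphy operators and the tangle encircling all strings\<close>

text \<open>Strings are numbered from 1.\<close>

definition sigma :: "nat \<Rightarrow> nat \<Rightarrow> (tangle \<Rightarrow>\<^sub>0 coeff) set" where
  "sigma n i = tangle_class n [(ups (i - 1), pos_cross Up Up, ups (n - i - 1))]"

text \<open>The word \<open>j-1, \<dots>, i+1, i, i+1, \<dots>, j-1\<close>; it is a reduced word for the transposition \<open>(i j)\<close>.\<close>

definition transposition_word :: "nat \<Rightarrow> nat \<Rightarrow> nat list" where
  "transposition_word i j = rev [i..<j] @ [Suc i..<j]"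

definition omega :: "nat \<Rightarrow> nat \<Rightarrow> nat \<Rightarrow> (tangle \<Rightarrow>\<^sub>0 coeff) set" where
  "omega n i j =
     foldr (\<lambda>k x. sigma n k \<otimes>\<^bsub>hecke n\<^esub> x) (transposition_word i j) \<one>\<^bsub>hecke n\<^esub>"

definition murphy :: "nat \<Rightarrow> nat \<Rightarrow> (tangle \<Rightarrow>\<^sub>0 coeff) set" where
  "murphy n j = (\<Oplus>\<^bsub>hecke n\<^esub>i\<in>{1..j - 1}. omega n i j)"

definition murphy_sum :: "nat \<Rightarrow> (tangle \<Rightarrow>\<^sub>0 coeff) set" where
  "murphy_sum n = (\<Oplus>\<^bsub>hecke n\<^esub>j\<in>{2..n}. murphy n j)"

text \<open>
  The loop starts at a minimum on the far left; its right-hand branch moves to the right across all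
  strings (the lower horizontal arc) and back to the left (the upper one), where it meets its
  left-hand branch in a maximum.  For \<open>h = Over\<close> the lower arc is the one in front of the strings
  and the loop is oriented counterclockwise, for \<open>h = Under\<close> the upper arc is the one in front and
  the loop is oriented clockwise.
\<close>

definition encircling :: "height \<Rightarrow> nat \<Rightarrow> tangle" where
  "encircling h n =
    (let d = (case h of Over \<Rightarrow> Up | Under \<Rightarrow> Down); c = rev_dir d in
      [([], Cup c, ups n)]
      @ map (\<lambda>k. (c # ups k, Cross h d Up, ups (n - k - 1))) [0..<n]
      @ map (\<lambda>k. (c # ups k, Cross h Up d, ups (n - k - 1))) (rev [0..<n])
      @ [([], Cap c, ups n)])"


section \<open>Basic facts about the definitions\<close>

lemma encircling_crossings_positive:
  assumes "(l, Cross k d e, r) \<in> set (encircling h n)"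
  shows "k = pos_height d e"
  using assms by (cases h) (auto simp: encircling_def Let_def pos_height_def)

lemma is_tangle_append:
  "is_tangle a t b \<Longrightarrow> is_tangle b t' c \<Longrightarrow> is_tangle a (t @ t') c"
  by (induction a t b rule: is_tangle.induct) auto

lemma encircling_tangle: "encircling h n \<in> tangles (ups n) (ups n)"
proof -
  define d where "d = (case h of Over \<Rightarrow> Up | Under \<Rightarrow> Down)"
  define c where "c = rev_dir d"
  have rc: "rev_dir c = d"
    by (cases d) (simp_all add: c_def)
  have lower: "is_tangle (c # d # ups n)
      (map (\<lambda>k. (c # ups k, Cross h d Up, ups (n - k - 1))) [0..<m])
      (c # ups m @ d # ups (n - m))" if "m \<le> n" for m
    using that
  proof (induction m)
    case (Suc m)
    define k where "k = n - Suc m"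
    with Suc.prems have k: "n - m = Suc k" "n - Suc m = k" "n - m - 1 = k"
      by auto
    have "is_tangle (c # ups m @ d # ups (n - m))
        [(c # ups m, Cross h d Up, ups (n - m - 1))] (c # ups (Suc m) @ d # ups (n - Suc m))"
      unfolding k by (simp add: replicate_app_Cons_same)
    from is_tangle_append[OF Suc.IH this] Suc.prems show ?case
      by (simp del: replicate.simps)
  qed simp
  have upper: "is_tangle (c # ups m @ d # ups (n - m))
      (map (\<lambda>k. (c # ups k, Cross h Up d, ups (n - k - 1))) (rev [0..<m]))
      (c # d # ups n)" if "m \<le> n" for m
    using that
  proof (induction m)
    case (Suc m)
    define k where "k = n - Suc m"
    with Suc.prems have k: "n - m = Suc k" "n - Suc m = k" "n - m - 1 = k"
      by auto
    have "is_tangle (c # ups (Suc m) @ d # ups (n - Suc m))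
        [(c # ups m, Cross h Up d, ups (n - m - 1))] (c # ups m @ d # ups (n - m))"
      unfolding k by (simp add: replicate_app_Cons_same)
    from is_tangle_append[OF this Suc.IH] Suc.prems show ?case
      by (simp del: replicate.simps)
  qed simp
  have bot: "is_tangle (ups n) [([], Cup c, ups n)] (c # d # ups n)"
    and top: "is_tangle (c # d # ups n) [([], Cap c, ups n)] (ups n)"
    by (simp_all add: rc)
  show ?thesis
    using is_tangle_append[OF bot is_tangle_append[OF lower[OF order_refl]
      is_tangle_append[OF upper[OF order_refl] top]]]
    unfolding encircling_def tangles_def Let_def d_def[symmetric] c_def[symmetric] by simp
qed

text \<open>The word used for \<open>omega\<close> is a reduced word for the transposition.\<close>

definition word_perm :: "nat list \<Rightarrow> nat \<Rightarrow> nat" where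
  "word_perm ws = foldr (\<lambda>k p. transpose k (Suc k) \<circ> p) ws id"

lemma word_perm_append: "word_perm (xs @ ys) = word_perm xs \<circ> word_perm ys"
  by (induction xs) (simp_all add: word_perm_def comp_assoc)

lemma word_perm_single: "word_perm [k] = transpose k (Suc k)"
  by (simp add: word_perm_def)

lemma transposition_word_perm:
  assumes "i < j"
  shows "word_perm (transposition_word i j) = transpose i j"
  using assms
proof (induction j)
  case (Suc j)
  show ?case
  proof (cases "i = j")
    case True
    then show ?thesis
      by (simp add: transposition_word_def word_perm_def)
  next
    case False
    with Suc have ij: "i < j" by simp
    then have "transposition_word i (Suc j) = [j] @ transposition_word i j @ [j]"
      by (simp add: transposition_word_def)
    then have "word_perm (transposition_word i (Suc j)) =
        transpose j (Suc j) \<circ> transpose i j \<circ> transpose j (Suc j)"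
      using Suc.IH[OF ij] word_perm_single[of j] by (simp only: word_perm_append comp_assoc)
    also have "\<dots> = transpose i (Suc j)"
      using ij by (auto simp: fun_eq_iff transpose_def)
    finally show ?thesis .
  qed
qed simp

lemma word_perm_inversions:
  "finite {(a, b). a < b \<and> word_perm ws b < word_perm ws a} \<and>
   card {(a, b). a < b \<and> word_perm ws b < word_perm ws a} \<le> length ws"
proof (induction ws)
  case Nil
  have "{(a, b). a < b \<and> word_perm [] b < word_perm [] a} = {}"
    by (auto simp: word_perm_def)
  then show ?case by (simp only:) simp
next
  case (Cons k ws)
  let ?p = "word_perm ws"
  let ?I = "\<lambda>p. {(a, b). a < b \<and> p b < (p a :: nat)} :: (nat \<times> nat) set"
  have p: "word_perm (k # ws) = transpose k (Suc k) \<circ> ?p"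
    by (simp add: word_perm_def)
  have inj: "inj ?p"
    by (induction ws) (auto simp: word_perm_def inj_def dest: transpose_eq_imp_eq)
  define S where "S = {(a, b). ?p a = k \<and> ?p b = Suc k}"
  have "S \<subseteq> {(inv_into UNIV ?p k, inv_into UNIV ?p (Suc k))}"
    using inj by (auto simp: S_def inv_f_eq)
  then have S: "finite S \<and> card S \<le> 1"
    by (metis card.empty card_mono finite.emptyI finite.insertI finite_subset is_singletonI
        is_singleton_altdef)
  have sub: "?I (word_perm (k # ws)) \<subseteq> ?I ?p \<union> S"
  proof (clarsimp simp: p S_def)
    fix a b
    assume ab: "a < b" "transpose k (Suc k) (?p b) < transpose k (Suc k) (?p a)"
      "?p a = k \<longrightarrow> ?p b \<noteq> Suc k"
    then have "?p a \<noteq> ?p b" by auto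
    with ab show "?p b < ?p a"
      by (auto simp: transpose_def split: if_splits)
  qed
  have "card (?I (word_perm (k # ws))) \<le> card (?I ?p \<union> S)"
    using sub S Cons by (intro card_mono) auto
  also have "\<dots> \<le> card (?I ?p) + card S"
    by (rule card_Un_le)
  finally show ?case
    using S Cons finite_subset[OF sub] by simp
qed

lemma transposition_word_reduced:
  assumes "i < j" "word_perm ws = transpose i j"
  shows "length (transposition_word i j) \<le> length ws"
proof -
  let ?I = "{(a, b). a < b \<and> transpose i j b < transpose i j a}"
  let ?A = "Pair i ` {Suc i..j}" and ?B = "(\<lambda>k. (k, j)) ` {Suc i..<j}"
  have "?A \<union> ?B \<subseteq> ?I"
    using assms by (auto simp: transpose_def)
  moreover have "card (?A \<union> ?B) = length (transposition_word i j)"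
    by (subst card_Un_disjoint) (auto simp: card_image inj_on_def transposition_word_def)
  ultimately show ?thesis
    using word_perm_inversions[of ws] assms(2) card_mono[of ?I "?A \<union> ?B"] by simp
qed

text \<open>The relations form an ideal, so that the operations of \<open>hecke n\<close> are well defined.\<close>

lemma lookup_scale: "Poly_Mapping.lookup (scale c x) t = c * Poly_Mapping.lookup x t"
  by (simp add: scale_def Poly_Mapping.map.rep_eq when_def)

lemma scale_add: "scale c (x + y) = scale c x + scale c y"
  by (rule poly_mapping_eqI) (simp add: lookup_scale lookup_add distrib_left)

lemma scale_diff: "scale c (x - y) = scale c x - scale c y"
  by (rule poly_mapping_eqI) (simp add: lookup_scale lookup_minus right_diff_distrib)

lemma scale_zero: "scale c 0 = 0"
  by (rule poly_mapping_eqI) (simp add: lookup_scale)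

lemma scale_sum: "scale c (sum f T) = (\<Sum>t\<in>T. scale c (f t))"
  by (induction T rule: infinite_finite_induct) (simp_all add: scale_zero scale_add)

lemma free_expansion:
  "(\<Sum>t\<in>Poly_Mapping.keys x. scale (Poly_Mapping.lookup x t) (diag t)) = x"
proof (rule poly_mapping_eqI)
  fix k
  have "Poly_Mapping.lookup (\<Sum>t\<in>Poly_Mapping.keys x. scale (Poly_Mapping.lookup x t) (diag t)) k =
      (\<Sum>t\<in>Poly_Mapping.keys x. if t = k then Poly_Mapping.lookup x t else 0)"
    unfolding lookup_sum
    by (intro sum.cong) (simp_all add: lookup_scale lookup_single when_def)
  then show "Poly_Mapping.lookup
      (\<Sum>t\<in>Poly_Mapping.keys x. scale (Poly_Mapping.lookup x t) (diag t)) k = Poly_Mapping.lookup x k"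
    by (simp add: sum.delta in_keys_iff)
qed

lemma scale_diag: "scale c (diag t) = Poly_Mapping.single t c"
  by (rule poly_mapping_eqI) (simp add: lookup_scale lookup_single when_def)

lemma scale_conv_mult: "scale c x = Poly_Mapping.single 0 c * x"
proof -
  have "Poly_Mapping.single 0 c * scale k (diag t) = scale c (scale k (diag t))" for k t
    by (rule poly_mapping_eqI)
      (simp add: scale_diag mult_single lookup_scale lookup_single when_def)
  then show ?thesis
    by (subst (1 2) free_expansion[of x, symmetric]) (simp only: scale_sum sum_distrib_left)
qed

lemma scale_mult_left: "scale c x * y = scale c (x * y)"
  unfolding scale_conv_mult by (simp only: mult.assoc)

lemma scale_mult_right: "x * scale c y = scale c (x * y)"
proof -
  have "scale k (diag t) * Poly_Mapping.single 0 c = Poly_Mapping.single 0 c * scale k (diag t)" for k t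
    by (simp add: scale_diag mult_single mult.commute)
  then have "x * Poly_Mapping.single 0 c = Poly_Mapping.single 0 c * x"
    by (subst (1 2) free_expansion[of x, symmetric]) (simp only: sum_distrib_left sum_distrib_right)
  then show ?thesis
    by (simp only: scale_conv_mult mult.assoc[symmetric])
qed

lemma diag_mult: "diag t * diag t' = diag (t @ t')"
  by (simp add: mult_single plus_list_def)

lemma skein_relations_uminus: "x \<in> skein_relations a b \<Longrightarrow> - x \<in> skein_relations a b"
proof -
  assume "x \<in> skein_relations a b"
  then have "scale (- 1) x \<in> skein_relations a b"
    by (rule skein_relations.scale)
  moreover have "scale (- 1) x = - x"
    by (rule poly_mapping_eqI) (simp add: lookup_scale)
  ultimately show ?thesis by simp
qed

lemma tangles_append: "t \<in> tangles a b \<Longrightarrow> t' \<in> tangles b c \<Longrightarrow> t @ t' \<in> tangles a c"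
  by (auto simp: tangles_def intro: is_tangle_append)

lemma plug_below: "t @ plug u l r w x = plug (t @ u) l r w x"
  by (simp add: plug_def)

lemma plug_above: "plug u l r w x @ t = plug u l r (w @ t) x"
  by (simp add: plug_def)

lemma skein_relations_stack_below:
  assumes "x \<in> skein_relations a b" and t: "t \<in> tangles c a"
  shows "diag t * x \<in> skein_relations c b"
  using assms(1)
proof induction
  case (move y y' C u l r w)
  then show ?case
    using t skein_relations.move[OF move(1) refl, of "t @ u" l r w c b]
    by (simp add: right_diff_distrib diag_mult tangles_append[OF t] flip: plug_below)
next
  case (skein C u l r w d e)
  then show ?case
    using t skein_relations.skein[OF refl, of "t @ u" l r w d e c b]
    by (simp add: right_diff_distrib diag_mult scale_mult_right tangles_append[OF t] flip: plug_below)
next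
  case (kink y d C u l r w)
  then show ?case
    using t skein_relations.kink[OF kink(1) refl, of "t @ u" l r w c b]
    by (simp add: right_diff_distrib diag_mult scale_mult_right tangles_append[OF t] flip: plug_below)
next
  case (loop C u l r w d)
  then show ?case
    using t skein_relations.loop[OF refl, of "t @ u" l r w d c b]
    by (simp add: right_diff_distrib diag_mult scale_mult_right tangles_append[OF t] flip: plug_below)
qed (simp_all add: distrib_left scale_mult_right skein_relations.zero
    skein_relations.add skein_relations.scale)

lemma skein_relations_stack_above:
  assumes "x \<in> skein_relations a b" and t: "t \<in> tangles b c"
  shows "x * diag t \<in> skein_relations a c"
  using assms(1)
proof induction
  case (move y y' C u l r w)
  then show ?case
    using t skein_relations.move[OF move(1) refl, of u l r "w @ t" a c]
    by (simp add: left_diff_distrib diag_mult tangles_append[OF _ t] flip: plug_above)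
next
  case (skein C u l r w d e)
  then show ?case
    using t skein_relations.skein[OF refl, of u l r "w @ t" d e a c]
    by (simp add: left_diff_distrib diag_mult scale_mult_left tangles_append[OF _ t] flip: plug_above)
next
  case (kink y d C u l r w)
  then show ?case
    using t skein_relations.kink[OF kink(1) refl, of u l r "w @ t" a c]
    by (simp add: left_diff_distrib diag_mult scale_mult_left tangles_append[OF _ t] flip: plug_above)
next
  case (loop C u l r w d)
  then show ?case
    using t skein_relations.loop[OF refl, of u l r "w @ t" d a c]
    by (simp add: left_diff_distrib diag_mult scale_mult_left tangles_append[OF _ t] flip: plug_above)
qed (simp_all add: distrib_right scale_mult_left skein_relations.zero
    skein_relations.add skein_relations.scale)

lemma skein_relations_sum:
  "(\<And>t. t \<in> T \<Longrightarrow> f t \<in> skein_relations a b) \<Longrightarrow> sum f T \<in> skein_relations a b"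
  by (induction T rule: infinite_finite_induct) (simp_all add: skein_relations.zero skein_relations.add)

lemma skein_relations_carrier:
  "x \<in> skein_relations a b \<Longrightarrow> Poly_Mapping.keys x \<subseteq> tangles a b"
proof (induction rule: skein_relations.induct)
  case (add x y)
  then show ?case using keys_add[of x y] by blast
next
  case (scale x c)
  then show ?case by (auto simp: in_keys_iff lookup_scale)
qed (auto simp: in_keys_iff lookup_minus lookup_scale lookup_single when_def split: if_splits)

lemma tangle_algebra_ring: "ring (tangle_algebra n)"
proof -
  let ?A = "tangle_algebra n"
  have neg: "Poly_Mapping.keys (- x) = Poly_Mapping.keys x" for x :: "tangle \<Rightarrow>\<^sub>0 coeff"
    by (auto simp: in_keys_iff)
  have mult: "Poly_Mapping.keys (x * y) \<subseteq> tangles a c"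
    if "Poly_Mapping.keys x \<subseteq> tangles a b" "Poly_Mapping.keys y \<subseteq> tangles b c" for x y :: "tangle \<Rightarrow>\<^sub>0 coeff" and a b c
    using keys_mult[of x y] that tangles_append by (fastforce simp: plus_list_def)
  have one: "Poly_Mapping.keys (1 :: tangle \<Rightarrow>\<^sub>0 coeff) \<subseteq> tangles a a" for a
    by (auto simp: tangles_def zero_list_def)
  show ?thesis
  proof (rule ringI)
    show "abelian_group ?A"
    proof (rule abelian_groupI)
      fix x y assume "x \<in> carrier ?A" "y \<in> carrier ?A"
      then show "x \<oplus>\<^bsub>?A\<^esub> y \<in> carrier ?A"
        using keys_add[of x y] by (auto simp: tangle_algebra_def)
    next
      fix x assume "x \<in> carrier ?A"
      then show "\<exists>y\<in>carrier ?A. y \<oplus>\<^bsub>?A\<^esub> x = \<zero>\<^bsub>?A\<^esub>"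
        by (intro bexI[of _ "- x"]) (auto simp: tangle_algebra_def neg)
    qed (auto simp: tangle_algebra_def algebra_simps)
    show "monoid ?A"
      by (rule monoidI) (use mult one in \<open>auto simp: tangle_algebra_def mult.assoc\<close>)
  qed (auto simp: tangle_algebra_def algebra_simps)
qed

lemma hecke_rels_ideal: "ideal (hecke_rels n) (tangle_algebra n)"
proof -
  let ?A = "tangle_algebra n" and ?I = "hecke_rels n"
  interpret A: ring ?A by (rule tangle_algebra_ring)
  show ?thesis
  proof (rule idealI[OF tangle_algebra_ring])
    show "subgroup ?I (add_monoid ?A)"
    proof (rule A.add.subgroupI)
      fix x assume x: "x \<in> ?I"
      then have "x \<in> carrier ?A" "- x \<in> ?I"
        using skein_relations_carrier skein_relations_uminus
        by (auto simp: hecke_rels_def tangle_algebra_def)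
      moreover from this have "\<ominus>\<^bsub>?A\<^esub> x = - x"
        using skein_relations_carrier[of "- x"]
        by (intro A.minus_equality) (auto simp: tangle_algebra_def hecke_rels_def)
      ultimately show "\<ominus>\<^bsub>?A\<^esub> x \<in> ?I"
        by simp
    qed (use skein_relations_carrier skein_relations.zero[of "ups n" "ups n"] in
        \<open>auto simp: hecke_rels_def tangle_algebra_def intro: skein_relations.add\<close>)
  next
    fix x y assume xy: "x \<in> ?I" "y \<in> carrier ?A"
    then have k: "t \<in> Poly_Mapping.keys y \<Longrightarrow> t \<in> tangles (ups n) (ups n)" for t
      by (auto simp: tangle_algebra_def)
    have "(\<Sum>t\<in>Poly_Mapping.keys y. scale (Poly_Mapping.lookup y t) (diag t)) * x \<in> ?I"
      using xy k unfolding hecke_rels_def sum_distrib_right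
      by (intro skein_relations_sum)
        (auto simp: scale_mult_left intro!: skein_relations.scale skein_relations_stack_below)
    then show "y \<otimes>\<^bsub>?A\<^esub> x \<in> ?I"
      by (simp add: free_expansion tangle_algebra_def)
    have "x * (\<Sum>t\<in>Poly_Mapping.keys y. scale (Poly_Mapping.lookup y t) (diag t)) \<in> ?I"
      using xy k unfolding hecke_rels_def sum_distrib_left
      by (intro skein_relations_sum)
        (auto simp: scale_mult_right intro!: skein_relations.scale skein_relations_stack_above)
    then show "x \<otimes>\<^bsub>?A\<^esub> y \<in> ?I"
      by (simp add: free_expansion tangle_algebra_def)
  qed
qed

lemma hecke_ring: "ring (hecke n)"
proof -
  let ?Q = "tangle_algebra n Quot hecke_rels n"
  interpret Q: ring ?Q
    by (rule ideal.quotient_is_ring[OF hecke_rels_ideal])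
  have eq: "carrier (hecke n) = carrier ?Q" "mult (hecke n) = mult ?Q" "one (hecke n) = one ?Q"
    "zero (hecke n) = zero ?Q" "add (hecke n) = add ?Q"
    by (simp_all add: hecke_def ring.defs)
  show ?thesis
  proof (rule ringI)
    show "abelian_group (hecke n)"
      by (rule abelian_groupI) (auto simp: eq Q.a_ac intro!: bexI[of _ "\<ominus>\<^bsub>?Q\<^esub> _"] Q.l_neg)
    show "monoid (hecke n)"
      by (rule monoidI) (auto simp: eq Q.m_assoc)
  qed (auto simp: eq Q.l_distr Q.r_distr)
qed

lemma tangle_class_closed:
  "t \<in> tangles (ups n) (ups n) \<Longrightarrow> tangle_class n t \<in> carrier (hecke n)"
  by (auto simp: tangle_class_def hecke_def ring.defs FactRing_def A_RCOSETS_def RCOSETS_def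
      a_r_coset_def tangle_algebra_def intro!: exI[of _ "diag t"])

lemma sigma_closed:
  assumes "1 \<le> i" "i < n"
  shows "sigma n i \<in> carrier (hecke n)"
proof -
  define k m where "k = i - 1" and "m = n - i - 1"
  with assms have "n = k + (2 + m)"
    by simp
  then have "ups n = ups k @ [Up, Up] @ ups m"
    by (simp add: replicate_add numeral_2_eq_2 replicate_app_Cons_same)
  then show ?thesis
    unfolding sigma_def k_def[symmetric] m_def[symmetric]
    by (intro tangle_class_closed) (simp add: tangles_def)
qed

lemma omega_closed:
  assumes "1 \<le> i" "i < j" "j \<le> n"
  shows "omega n i j \<in> carrier (hecke n)"
proof -
  interpret ring "hecke n" by (rule hecke_ring)
  have "foldr (\<lambda>k x. sigma n k \<otimes>\<^bsub>hecke n\<^esub> x) ws \<one>\<^bsub>hecke n\<^esub> \<in> carrier (hecke n)"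
    if "set ws \<subseteq> {1..<n}" for ws
    using that by (induction ws) (auto intro!: m_closed sigma_closed)
  moreover have "set (transposition_word i j) \<subseteq> {1..<n}"
    using assms by (auto simp: transposition_word_def)
  ultimately show ?thesis
    unfolding omega_def by blast
qed

lemma hecke_smult:
  assumes "x \<in> carrier (tangle_algebra n)"
  shows "c \<odot>\<^bsub>hecke n\<^esub> (hecke_rels n +>\<^bsub>tangle_algebra n\<^esub> x) =
    hecke_rels n +>\<^bsub>tangle_algebra n\<^esub> (scale c x)"
proof -
  let ?A = "tangle_algebra n" and ?I = "hecke_rels n"
  interpret I: ideal ?I ?A by (rule hecke_rels_ideal)
  have sc: "scale c y \<in> carrier ?A" if "y \<in> carrier ?A" for y
    using that by (auto simp: tangle_algebra_def in_keys_iff lookup_scale)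
  have "?I +>\<^bsub>?A\<^esub> scale c y = ?I +>\<^bsub>?A\<^esub> scale c x" if "y \<in> ?I +>\<^bsub>?A\<^esub> x" for y
  proof -
    from that obtain r where r: "r \<in> ?I" "y = r + x"
      by (auto simp: a_r_coset_def r_coset_def tangle_algebra_def)
    then have "scale c y = scale c r \<oplus>\<^bsub>?A\<^esub> scale c x"
      by (intro poly_mapping_eqI) (simp add: tangle_algebra_def lookup_scale lookup_add algebra_simps)
    moreover have "scale c r \<in> ?I"
      using r by (simp add: hecke_rels_def skein_relations.scale)
    ultimately have "scale c y \<in> ?I +>\<^bsub>?A\<^esub> scale c x"
      by (auto simp: a_r_coset_def r_coset_def)
    then show ?thesis
      using I.a_repr_independence sc[OF assms] I.is_additive_subgroup
      by (metis additive_subgroup.a_subgroup I.a_repr_independence)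
  qed
  moreover have "x \<in> ?I +>\<^bsub>?A\<^esub> x"
    using I.a_rcos_self assms by simp
  moreover have "c \<odot>\<^bsub>hecke n\<^esub> X = (\<Union>y\<in>X. ?I +>\<^bsub>?A\<^esub> scale c y)" for X
    by (simp add: hecke_def ring.defs module.defs) (simp add: tangle_algebra_def)
  ultimately show ?thesis
    by blast
qed

end

theory Submission
  imports Defs
begin

text \<open>
  Write
  \<open>J\<^sub>k = \<sigma>\<^sub>k\<^sub>-\<^sub>1 \<dots> \<sigma>\<^sub>1 \<sigma>\<^sub>1 \<dots> \<sigma>\<^sub>k\<^sub>-\<^sub>1\<close> for the braid in which string \<open>k\<close> runs behind the \<open>k - 1\<close> strings on
  its left and back in front of them.  The proof expands both the loop and the braids \<open>J\<^sub>k\<close>, each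
  time by the skein relation at one crossing of a clasp.

  In the loop around the first \<open>k\<close> strings, the branch of the loop meets string \<open>k\<close> in two successive
  positive crossings.  Changing the second crossing frees string \<open>k\<close> from the loop, by the second
  Reidemeister move; smoothing it merges the loop with string \<open>k\<close>, and the result is \<open>J\<^sub>k\<close> with one
  additional positive curl (lemma \<open>encircling_step\<close>).  Hence
  \[ T^{(n)} = \delta + z v^{-1} \sum_{k=1}^n J_k . \]
  In \<open>J\<^sub>k\<close> the middle factor is the square \<open>\<sigma>\<^sub>1\<^sup>2 = 1 + z \<sigma>\<^sub>1\<close>; its two terms are a braid of the same
  shape with \<open>\<sigma>\<^sub>1\<close> omitted, and the braid \<open>\<omega>\<close> of the transposition \<open>(1 k)\<close>.  Repeating this with
  \<open>\<sigma>\<^sub>2, \<dots>, \<sigma>\<^sub>k\<^sub>-\<^sub>1\<close> yields \<open>J\<^sub>k = 1 + z M(k)\<close> (lemma \<open>pass_word_expansion\<close>).  Together,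
  \[ T^{(n)} = (\delta + n z v^{-1}) \cdot 1 + z^2 v^{-1} M , \]
  and \<open>z\<^sup>2 v\<^sup>-\<^sup>1\<close> is a unit.

  The two heights of the lower arc give loops of opposite rotation in the plane, and
  smoothing leads to different pictures.  If the lower arc is in front, the merged string runs
  \<open>\<sigma>\<^sub>1 \<dots> \<sigma>\<^sub>k \<dots> \<sigma>\<^sub>1\<close> with its first string closed up on the left; the braid relations turn this into
  \<open>\<sigma>\<^sub>k \<dots> \<sigma>\<^sub>1 \<dots> \<sigma>\<^sub>k\<close>, where the closed string meets only \<open>\<sigma>\<^sub>1\<close> and forms a curl (lemmas \<open>braid_pass\<close> and
  \<open>pull_over\<close>).  If the lower arc is behind, the smoothing is a maximum below a minimum, and sliding
  the minimum of the lower half and the minimum of the upper half across the other strings leaves a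
  curl and a braid (lemma \<open>pull_under\<close>).
\<close>

section \<open>Regular isotopy of layered diagrams\<close>

definition widen :: "dir list \<Rightarrow> dir list \<Rightarrow> tangle \<Rightarrow> tangle" where
  "widen l r t = map (\<lambda>(a, p, b). (l @ a, p, b @ r)) t"

lemma widen_simps [simp]:
  "widen l r [] = []"
  "widen l r ((a, p, b) # t) = (l @ a, p, b @ r) # widen l r t"
  "widen l r (t @ t') = widen l r t @ widen l r t'"
  "widen [] [] t = t"
  "widen l r (widen l' r' t) = widen (l @ l') (r' @ r) t"
  by (auto simp: widen_def)

lemma plug_widen: "plug u l r w t = u @ widen l r t @ w"
  by (simp add: plug_def widen_def)

text \<open>
  Relations of the skein module concern only diagrams whose strand directions match.  Moves preserve
  matching directions from left to right, and also from right to left except for the two that create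
  strands out of nothing (the zigzags and the second Reidemeister move), since a new pair of extrema
  or crossings might carry the wrong directions.  Excluding those reversals makes it possible to
  reason about untyped diagrams: along a reduction, it suffices that the first one is well typed.
\<close>

inductive reduces :: "tangle \<Rightarrow> tangle \<Rightarrow> bool" where
  move: "diagram_move t t' \<Longrightarrow> reduces (u @ widen l r t @ w) (u @ widen l r t' @ w)"
| unmove: "diagram_move t t' \<Longrightarrow> t' \<noteq> [] \<Longrightarrow> reduces (u @ widen l r t' @ w) (u @ widen l r t @ w)"
| refl: "reduces t t"
| trans [trans]: "reduces t t' \<Longrightarrow> reduces t' t'' \<Longrightarrow> reduces t t''"

lemma is_tangle_append_iff:
  "is_tangle a (x @ y) b \<longleftrightarrow> (\<exists>c. is_tangle a x c \<and> is_tangle c y b)"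
  by (induction a x b rule: is_tangle.induct) auto

lemma is_tangle_widen: "is_tangle a t b \<Longrightarrow> is_tangle (l @ a @ r) (widen l r t) (l @ b @ r)"
  by (induction a t b rule: is_tangle.induct) auto

lemma is_tangle_widenD:
  assumes "is_tangle a (widen l r t) b" "t \<noteq> []"
  shows "\<exists>a' b'. a = l @ a' @ r \<and> b = l @ b' @ r \<and> is_tangle a' t b'"
proof -
  have "is_tangle (l @ a' @ r) (widen l r t) b \<Longrightarrow> \<exists>b'. b = l @ b' @ r \<and> is_tangle a' t b'" for a'
  proof (induction t arbitrary: a')
    case (Cons x t)
    obtain k p m where x: "x = (k, p, m)" by (cases x)
    with Cons.prems Cons.IH[of "k @ piece_top p @ m"] show ?case by auto
  qed auto
  moreover obtain k p m t' where "t = (k, p, m) # t'"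
    using assms(2) by (cases t) auto
  ultimately show ?thesis
    using assms(1) by (metis append.assoc is_tangle.simps(2) widen_simps(2))
qed

lemma is_tangle_local:
  assumes "is_tangle a (u @ widen l r t @ w) b" "t \<noteq> []"
    and "\<And>a b. is_tangle a t b \<Longrightarrow> is_tangle a t' b"
  shows "is_tangle a (u @ widen l r t' @ w) b"
  using assms(1) is_tangle_widenD[OF _ assms(2)] assms(3) is_tangle_widen
  unfolding is_tangle_append_iff by metis

lemma rev_dir_rev_dir [simp]: "rev_dir (rev_dir d) = d"
  by (cases d) auto

lemma diagram_move_nonempty: "diagram_move t t' \<Longrightarrow> t \<noteq> []"
  by (induction rule: diagram_move.induct) auto

lemma diagram_move_tangle: "diagram_move t t' \<Longrightarrow> is_tangle a t b \<Longrightarrow> is_tangle a t' b"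
  by (induction rule: diagram_move.induct) auto

lemma diagram_unmove_tangle:
  "diagram_move t t' \<Longrightarrow> t' \<noteq> [] \<Longrightarrow> is_tangle a t' b \<Longrightarrow> is_tangle a t b"
  by (induction rule: diagram_move.induct) auto

lemma reduces_sound:
  assumes "reduces t t'" "t \<in> tangles a b"
  shows "t' \<in> tangles a b \<and> diag t - diag t' \<in> skein_relations a b"
  using assms
proof induction
  case (move t t' u l r w)
  have "u @ widen l r t' @ w \<in> tangles a b"
    using is_tangle_local[OF _ diagram_move_nonempty[OF move(1)] diagram_move_tangle[OF move(1)]] move(2)
    by (simp add: tangles_def)
  then show ?case
    using skein_relations.move[OF move(1) HOL.refl, of u l r w a b] move(2)
    by (simp add: plug_widen)
next
  case (unmove t t' u l r w)
  have *: "u @ widen l r t @ w \<in> tangles a b"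
    using is_tangle_local[OF _ unmove(2) diagram_unmove_tangle[OF unmove(1,2)]] unmove(3)
    by (simp add: tangles_def)
  then have "diag (u @ widen l r t @ w) - diag (u @ widen l r t' @ w) \<in> skein_relations a b"
    using skein_relations.move[OF unmove(1) HOL.refl, of u l r w a b] unmove(3)
    by (simp add: plug_widen)
  from skein_relations_uminus[OF this] * show ?case by simp
next
  case (trans t t' t'')
  then show ?case
    using skein_relations.add[of "diag t - diag t'" a b "diag t' - diag t''"] by simp
qed (simp add: skein_relations.zero)

lemma reduces_context:
  "reduces t t' \<Longrightarrow> reduces (u @ widen l r t @ w) (u @ widen l r t' @ w)"
proof (induction rule: reduces.induct)
  case (move t t' u' l' r' w')
  show ?case
    using reduces.move[OF move, of "u @ widen l r u'" "l @ l'" "r' @ r" "widen l r w' @ w"] by simp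
next
  case (unmove t t' u' l' r' w')
  show ?case
    using reduces.unmove[OF unmove, of "u @ widen l r u'" "l @ l'" "r' @ r" "widen l r w' @ w"] by simp
qed (auto intro: reduces.intros)

definition reduces_both :: "tangle \<Rightarrow> tangle \<Rightarrow> bool" where
  "reduces_both t t' \<longleftrightarrow> reduces t t' \<and> reduces t' t"

lemma reduces_bothD: "reduces_both t t' \<Longrightarrow> reduces t t'" "reduces_both t t' \<Longrightarrow> reduces t' t"
  by (simp_all add: reduces_both_def)

lemma reduces_both_trans [trans]:
  "reduces_both t t' \<Longrightarrow> reduces_both t' t'' \<Longrightarrow> reduces_both t t''"
  unfolding reduces_both_def by (blast intro: reduces.trans)

lemma reduces_both_context:
  "reduces_both t t' \<Longrightarrow> reduces_both (u @ widen l r t @ w) (u @ widen l r t' @ w)"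
  unfolding reduces_both_def by (blast intro: reduces_context)

lemma reduces_both_move:
  "diagram_move t t' \<Longrightarrow> t' \<noteq> [] \<Longrightarrow> reduces_both (u @ widen l r t @ w) (u @ widen l r t' @ w)"
  unfolding reduces_both_def by (blast intro: reduces.move reduces.unmove)

text \<open>
  Iterating the exchange of two neighbouring pieces moves a layer past a whole diagram, and then a
  whole diagram past another one that lies to its right.
\<close>

lemma exchange_layer_tangle:
  "is_tangle c s d \<Longrightarrow>
   reduces_both ((l, p, r @ c) # widen (l @ piece_top p @ r) [] s)
     (widen (l @ piece_bot p @ r) [] s @ [(l, p, r @ d)])"
proof (induction c s d rule: is_tangle.induct)
  case (1 a b)
  then show ?case by (simp add: reduces_both_def reduces.refl)
next
  case (2 c l' q r' s d)
  have "reduces_both ((l, p, r @ c) # widen (l @ piece_top p @ r) [] ((l', q, r') # s))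
     ((l @ piece_bot p @ r @ l', q, r') # (l, p, r @ l' @ piece_top q @ r')
        # widen (l @ piece_top p @ r) [] s)"
    using reduces_both_move[OF diagram_move.exchange[of p "r @ l'" q], of "[]" l r'
        "widen (l @ piece_top p @ r) [] s"] 2(2) by simp
  also have "reduces_both \<dots>
      ((l @ piece_bot p @ r @ l', q, r') # widen (l @ piece_bot p @ r) [] s @ [(l, p, r @ d)])"
    using reduces_both_context[OF 2(1), of "[(l @ piece_bot p @ r @ l', q, r')]" "[]" "[]" "[]"] 2(2)
    by simp
  finally show ?case by simp
qed

lemma exchange_tangles:
  assumes "is_tangle a t b" "is_tangle c s d"
  shows "reduces_both (widen [] c t @ widen b [] s) (widen a [] s @ widen [] d t)"
  using assms
proof (induction a t b rule: is_tangle.induct)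
  case (1 a b)
  then show ?case by (simp add: reduces_both_def reduces.refl)
next
  case (2 a l p r t b)
  have "reduces_both (widen [] c ((l, p, r) # t) @ widen b [] s)
      ((l, p, r @ c) # widen (l @ piece_top p @ r) [] s @ widen [] d t)"
    using reduces_both_context[OF 2(1), of "[(l, p, r @ c)]" "[]" "[]" "[]"] 2(2,3) by simp
  also have "reduces_both \<dots> (widen (l @ piece_bot p @ r) [] s @ [(l, p, r @ d)] @ widen [] d t)"
    using reduces_both_context[OF exchange_layer_tangle[OF 2(3), of l p r], of "[]" "[]" "[]" "widen [] d t"] by simp
  finally show ?case using 2(2) by simp
qed

section \<open>Strings passing across a row of upward strings\<close>

text \<open>
  A string directed by \<open>d\<close> runs from the far left to the far right, or back, across \<open>m\<close> upward strings;
  \<open>h\<close> is the height of whichever string joins bottom left to top right, so that on the way back the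
  string itself has height \<open>flip h\<close>.
\<close>

primrec pass_right :: "height \<Rightarrow> dir \<Rightarrow> nat \<Rightarrow> tangle" where
  "pass_right h d 0 = []"
| "pass_right h d (Suc m) = widen [] [Up] (pass_right h d m) @ [(ups m, Cross h d Up, [])]"

primrec pass_left :: "height \<Rightarrow> dir \<Rightarrow> nat \<Rightarrow> tangle" where
  "pass_left h d 0 = []"
| "pass_left h d (Suc m) = (ups m, Cross h Up d, []) # widen [] [Up] (pass_left h d m)"

lemma ups_shift: "ups m @ Up # r = Up # ups m @ r"
  by (rule replicate_app_Cons_same)

lemma ups_snoc: "ups m @ [Up] = Up # ups m"
  using ups_shift[of m "[]"] by simp

lemma pass_right_tangle: "is_tangle (d # ups m) (pass_right h d m) (ups m @ [d])"
proof (induction m)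
  case (Suc m)
  then show ?case
    using is_tangle_widen[OF Suc, of "[]" "[Up]"]
    by (auto simp: is_tangle_append_iff ups_shift ups_snoc)
qed simp

lemma pass_left_tangle: "is_tangle (ups m @ [d]) (pass_left h d m) (d # ups m)"
proof (induction m)
  case (Suc m)
  then show ?case
    using is_tangle_widen[OF Suc, of "[]" "[Up]"]
    by (simp add: ups_shift ups_snoc)
qed simp

lemma widen_pass_right:
  "widen [] (ups q) (pass_right h d m) =
     map (\<lambda>k. (ups k, Cross h d Up, ups (m + q - k - 1))) [0..<m]"
proof (induction m arbitrary: q)
  case (Suc m)
  from Suc[of "Suc q"] show ?case by simp
qed simp

lemma widen_pass_left:
  "widen [] (ups q) (pass_left h d m) =
     map (\<lambda>k. (ups k, Cross h Up d, ups (m + q - k - 1))) (rev [0..<m])"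
proof (induction m arbitrary: q)
  case (Suc m)
  from Suc[of "Suc q"] show ?case by simp
qed simp

text \<open>
  This is \<open>\<sigma>\<^sub>1 \<dots> \<sigma>\<^sub>m \<sigma>\<^sub>m\<^sub>+\<^sub>1 \<sigma>\<^sub>m \<dots> \<sigma>\<^sub>1 = \<sigma>\<^sub>m\<^sub>+\<^sub>1 \<dots> \<sigma>\<^sub>2 \<sigma>\<^sub>1 \<sigma>\<^sub>2 \<dots> \<sigma>\<^sub>m\<^sub>+\<^sub>1\<close>: the third Reidemeister move in the middle
  brings two copies of the last generator to the outside of the innermost factors, and they commute
  with all the remaining ones.
\<close>

lemma braid_pass:
  "reduces (pass_right Over Up (Suc m) @ widen [] [Up] (pass_left Over Up m))
     (widen [Up] [] (pass_left Over Up m) @ [([], Cross Over Up Up, ups m)]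
        @ widen [Up] [] (pass_right Over Up m))"
proof (induction m)
  case 0
  show ?case by (simp add: reduces.refl)
next
  case (Suc m)
  let ?X = "Cross Over Up Up" and ?R = "pass_right Over Up m" and ?L = "pass_left Over Up m"
  have braid: "diagram_move [([], ?X, [Up]), ([Up], ?X, []), ([], ?X, [Up])]
      [([Up], ?X, []), ([], ?X, [Up]), ([Up], ?X, [])]"
    using diagram_move.reid3[of Over Over Over Up Up Up] by simp
  have last: "is_tangle [Up, Up] [([], ?X, [])] [Up, Up]"
    by simp
  have "reduces (pass_right Over Up (Suc (Suc m)) @ widen [] [Up] (pass_left Over Up (Suc m)))
     (widen [] [Up, Up] ?R @ [(ups m, ?X, [Up]), (Up # ups m, ?X, []), (ups m, ?X, [Up])]
        @ widen [] [Up, Up] ?L)"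
    by (simp add: reduces.refl)
  also have "reduces \<dots>
     (widen [] [Up, Up] ?R @ [(Up # ups m, ?X, []), (ups m, ?X, [Up]), (Up # ups m, ?X, [])]
        @ widen [] [Up, Up] ?L)"
    using reduces.move[OF braid, of "widen [] [Up, Up] ?R" "ups m" "[]" "widen [] [Up, Up] ?L"]
    by (simp add: ups_shift ups_snoc)
  also have "reduces \<dots>
     ((Up # ups m, ?X, []) # widen [] [Up, Up] ?R @ [(ups m, ?X, [Up]), (Up # ups m, ?X, [])]
        @ widen [] [Up, Up] ?L)"
    using reduces_context[OF exchange_tangles[OF pass_right_tangle[of Up m Over] last, THEN reduces_bothD(1)],
        of "[]" "[]" "[]" "[(ups m, ?X, [Up]), (Up # ups m, ?X, [])] @ widen [] [Up, Up] ?L"]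
    by (simp add: ups_shift ups_snoc)
  also have "reduces \<dots>
     ((Up # ups m, ?X, []) # widen [] [Up, Up] ?R @ [(ups m, ?X, [Up])]
        @ widen [] [Up, Up] ?L @ [(Up # ups m, ?X, [])])"
    using reduces_context[OF exchange_tangles[OF pass_left_tangle[of m Up Over] last, THEN reduces_bothD(2)],
        of "(Up # ups m, ?X, []) # widen [] [Up, Up] ?R @ [(ups m, ?X, [Up])]" "[]" "[]" "[]"]
    by (simp add: ups_shift ups_snoc)
  also have "reduces \<dots>
     ((Up # ups m, ?X, []) # widen [Up] [Up] ?L @ [([], ?X, ups m @ [Up])]
        @ widen [Up] [Up] ?R @ [(Up # ups m, ?X, [])])"
    using reduces_context[OF Suc, of "[(Up # ups m, ?X, [])]" "[]" "[Up]" "[(Up # ups m, ?X, [])]"]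
    by simp
  finally show ?case
    by (simp add: ups_snoc)
qed

section \<open>The loop merged with a string\<close>

text \<open>
  The lower arc runs in front.  After \<open>braid_pass\<close> the first string takes part in a single crossing,
  and everything else moves out from between the minimum and the maximum that close it up.
\<close>

lemma pull_over:
  "reduces ([([], Cup Down, ups (Suc m))]
      @ widen [Down] [] (pass_right Over Up (Suc m) @ widen [] [Up] (pass_left Over Up m))
      @ [([], Cap Down, ups (Suc m))])
    (pass_left Over Up m @ widen [] (ups m) (curl_left Up) @ pass_right Over Up m)"
proof -
  let ?X = "Cross Over Up Up" and ?R = "pass_right Over Up m" and ?L = "pass_left Over Up m"
  have cup: "is_tangle [] [([], Cup Down, [])] [Down, Up]"
    and cap: "is_tangle [Down, Up] [([], Cap Down, [])] []"
    by simp_all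
  have "reduces ([([], Cup Down, ups (Suc m))]
      @ widen [Down] [] (pass_right Over Up (Suc m) @ widen [] [Up] ?L)
      @ [([], Cap Down, ups (Suc m))])
    ([([], Cup Down, ups (Suc m))] @ widen [Down, Up] [] ?L @ [([Down], ?X, ups m)]
       @ widen [Down, Up] [] ?R @ [([], Cap Down, ups (Suc m))])"
    using reduces_context[OF braid_pass[of m], of "[([], Cup Down, ups (Suc m))]" "[Down]" "[]"
        "[([], Cap Down, ups (Suc m))]"] by simp
  also have "reduces \<dots>
    (?L @ [([], Cup Down, ups (Suc m)), ([Down], ?X, ups m)]
       @ widen [Down, Up] [] ?R @ [([], Cap Down, ups (Suc m))])"
    using reduces_context[OF exchange_tangles[OF cup pass_left_tangle[of m Up Over], THEN reduces_bothD(1)],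
        of "[]" "[]" "[]" "[([Down], ?X, ups m)] @ widen [Down, Up] [] ?R @ [([], Cap Down, ups (Suc m))]"]
    by (simp add: ups_snoc)
  also have "reduces \<dots>
    (?L @ [([], Cup Down, ups (Suc m)), ([Down], ?X, ups m), ([], Cap Down, ups (Suc m))] @ ?R)"
    using reduces_context[OF exchange_tangles[OF cap pass_right_tangle[of Up m Over], THEN reduces_bothD(2)],
        of "?L @ [([], Cup Down, ups (Suc m)), ([Down], ?X, ups m)]" "[]" "[]" "[]"]
    by (simp add: ups_snoc)
  finally show ?thesis
    by (simp add: curl_left_def pos_height_def)
qed

text \<open>
  The lower arc runs behind.  Its minimum on the far left is pulled to the right behind the upward
  strings, which turns the downward branch behind them into an upward one.
\<close>

lemma cup_slide_row:
  "reduces (([], Cup Up, ups m) # widen [Up] [] (pass_right Under Down m))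
     ((ups m, Cup Up, []) # widen [] [Down] (pass_left Over Up m))"
proof (induction m)
  case 0
  show ?case by (simp add: reduces.refl)
next
  case (Suc m)
  let ?L = "pass_left Over Up m" and ?A = "Cross Under Down Up"
  have slide: "diagram_move [([Up], Cup Up, []), ([], Cross Over Up Up, [Down])]
      [([], Cup Up, [Up]), ([Up], ?A, [])]"
    using diagram_move.cup_slide[of Up Up Over] by simp
  have last: "is_tangle [Down, Up] [([], ?A, [])] [Up, Down]"
    by simp
  have "reduces (([], Cup Up, ups (Suc m)) # widen [Up] [] (pass_right Under Down (Suc m)))
     ((ups m, Cup Up, [Up]) # widen [] [Down, Up] ?L @ [(Up # ups m, ?A, [])])"
    using reduces_context[OF Suc, of "[]" "[]" "[Up]" "[(Up # ups m, ?A, [])]"]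
    by (simp add: ups_snoc)
  also have "reduces \<dots> ([(ups m, Cup Up, [Up]), (Up # ups m, ?A, [])] @ widen [] [Up, Down] ?L)"
    using reduces_context[OF exchange_tangles[OF pass_left_tangle[of m Up Over] last, THEN reduces_bothD(1)],
        of "[(ups m, Cup Up, [Up])]" "[]" "[]" "[]"]
    by (simp add: ups_snoc)
  also have "reduces \<dots>
      ([(ups (Suc m), Cup Up, []), (ups m, Cross Over Up Up, [Down])] @ widen [] [Up, Down] ?L)"
    using reduces.unmove[OF slide, of "[]" "ups m" "[]" "widen [] [Up, Down] ?L"]
    by (simp add: ups_snoc)
  finally show ?case by simp
qed

text \<open>
  The upper half of the merged string rises on the far left, turns over a maximum, and descends to the
  right in front of the other strings into a minimum.  Pulling that minimum back to the left
  straightens it.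
\<close>

lemma cup_cap_row:
  "reduces ((Up # ups m, Cup Down, []) # widen [Up] [Up] (pass_left Under Down m)
        @ [([], Cap Up, ups (Suc m))])
     (pass_right Over Up m)"
proof (induction m)
  case 0
  have "diagram_move [([Up], Cup Down, []), ([], Cap Up, [Up])] []"
    using diagram_move.zigzag_right[of Up] by simp
  from reduces.move[OF this, of "[]" "[]" "[]" "[]"] show ?case by simp
next
  case (Suc m)
  let ?L = "pass_left Under Down m" and ?B = "Cross Under Up Down" and ?X = "Cross Over Up Up"
  have slide: "diagram_move [([Up], Cup Down, []), ([], ?B, [Up])]
      [([], Cup Down, [Up]), ([Down], ?X, [])]"
    using diagram_move.cup_slide[of Up Down Under] by simp
  have last: "is_tangle [Up, Up] [([], ?X, [])] [Up, Up]"
    by simp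
  have row: "is_tangle (Up # ups m @ [Down]) (widen [Up] [] ?L @ [([], Cap Up, ups m)]) (ups m)"
    using is_tangle_widen[OF pass_left_tangle[of m Down Under], of "[Up]" "[]"]
    by (auto simp: is_tangle_append_iff)
  have "reduces ((Up # ups (Suc m), Cup Down, []) # widen [Up] [Up] (pass_left Under Down (Suc m))
        @ [([], Cap Up, ups (Suc (Suc m)))])
      ([(Up # ups m, Cup Down, [Up]), (Up # ups m @ [Down], ?X, [])]
        @ widen [Up] [Up, Up] ?L @ [([], Cap Up, ups (Suc (Suc m)))])"
    using reduces.move[OF slide, of "[]" "Up # ups m" "[]"
        "widen [Up] [Up, Up] ?L @ [([], Cap Up, ups (Suc (Suc m)))]"]
    by (simp add: ups_snoc)
  also have "reduces \<dots>
      ([(Up # ups m, Cup Down, [Up])] @ widen [Up] [Up, Up] ?L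
        @ [([], Cap Up, ups (Suc (Suc m))), (ups m, ?X, [])])"
    using reduces_context[OF exchange_tangles[OF row last, THEN reduces_bothD(2)],
        of "[(Up # ups m, Cup Down, [Up])]" "[]" "[]" "[]"]
    by (simp add: ups_shift ups_snoc)
  also have "reduces \<dots> (widen [] [Up] (pass_right Over Up m) @ [(ups m, ?X, [])])"
    using reduces_context[OF Suc, of "[]" "[]" "[Up]" "[(ups m, ?X, [])]"]
    by (simp add: ups_snoc)
  finally show ?case by simp
qed

text \<open>
  The maximum of the lower half and the crossing next to it form a curl at the pulled minimum of
  \<open>cup_slide_row\<close>; the remaining crossings lie to the left of that maximum and move above it.
\<close>

lemma pull_under:
  "reduces ([([], Cup Up, ups (Suc m))]
      @ widen [Up] [] (pass_right Under Down (Suc m))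
      @ [(Up # ups m, Cap Up, []), (Up # ups m, Cup Down, [])]
      @ widen [Up] [Up] (pass_left Under Down m)
      @ [([], Cap Up, ups (Suc m))])
    (widen (ups m) [] (curl_right Up) @ pass_left Over Up m @ pass_right Over Up m)"
proof -
  let ?L = "pass_left Over Up m" and ?X = "Cross Over Up Up"
  have cap: "is_tangle [Up, Down] [([], Cap Up, [])] []"
    by simp
  have "reduces ([([], Cup Up, ups (Suc m))]
      @ widen [Up] [] (pass_right Under Down (Suc m))
      @ [(Up # ups m, Cap Up, []), (Up # ups m, Cup Down, [])]
      @ widen [Up] [Up] (pass_left Under Down m)
      @ [([], Cap Up, ups (Suc m))])
    ([(ups (Suc m), Cup Up, []), (ups m, ?X, [Down])] @ widen [] [Up, Down] ?L
      @ [(Up # ups m, Cap Up, []), (Up # ups m, Cup Down, [])]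
      @ widen [Up] [Up] (pass_left Under Down m)
      @ [([], Cap Up, ups (Suc m))])"
    using reduces_context[OF cup_slide_row[of "Suc m"], of "[]" "[]" "[]"
        "[(Up # ups m, Cap Up, []), (Up # ups m, Cup Down, [])]
         @ widen [Up] [Up] (pass_left Under Down m) @ [([], Cap Up, ups (Suc m))]"]
    by simp
  also have "reduces \<dots>
    ([(ups (Suc m), Cup Up, []), (ups m, ?X, [Down])] @ widen [] [Up, Down] ?L
      @ [(Up # ups m, Cap Up, [])] @ pass_right Over Up m)"
    using reduces_context[OF cup_cap_row[of m], of "[(ups (Suc m), Cup Up, []), (ups m, ?X, [Down])]
        @ widen [] [Up, Down] ?L @ [(Up # ups m, Cap Up, [])]" "[]" "[]" "[]"]
    by simp
  also have "reduces \<dots>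
    ([(ups (Suc m), Cup Up, []), (ups m, ?X, [Down]), (Up # ups m, Cap Up, [])] @ ?L
      @ pass_right Over Up m)"
    using reduces_context[OF exchange_tangles[OF pass_left_tangle[of m Up Over] cap, THEN reduces_bothD(1)],
        of "[(ups (Suc m), Cup Up, []), (ups m, ?X, [Down])]" "[]" "[]" "pass_right Over Up m"]
    by (simp add: ups_snoc)
  finally show ?thesis
    by (simp add: curl_right_def pos_height_def ups_snoc)
qed

section \<open>Linear relations between diagrams\<close>

definition skein_eq :: "dir list \<Rightarrow> dir list \<Rightarrow> (tangle \<Rightarrow>\<^sub>0 coeff) \<Rightarrow> (tangle \<Rightarrow>\<^sub>0 coeff) \<Rightarrow> bool" where
  "skein_eq a b x y \<longleftrightarrow> x - y \<in> skein_relations a b"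

lemma skein_eq_refl: "skein_eq a b x x"
  by (simp add: skein_eq_def skein_relations.zero)

lemma skein_eq_trans [trans]: "skein_eq a b x y \<Longrightarrow> skein_eq a b y w \<Longrightarrow> skein_eq a b x w"
  unfolding skein_eq_def using skein_relations.add[of "x - y" a b "y - w"] by simp

lemma skein_eq_add:
  "skein_eq a b x x' \<Longrightarrow> skein_eq a b y y' \<Longrightarrow> skein_eq a b (x + y) (x' + y')"
  unfolding skein_eq_def using skein_relations.add[of "x - x'" a b "y - y'"]
  by (simp add: algebra_simps)

lemma skein_eq_scale: "skein_eq a b x y \<Longrightarrow> skein_eq a b (scale c x) (scale c y)"
  unfolding skein_eq_def scale_diff[symmetric] by (rule skein_relations.scale)

lemma skein_eq_sum:
  "(\<And>i. i \<in> S \<Longrightarrow> skein_eq a b (f i) (g i)) \<Longrightarrow> skein_eq a b (sum f S) (sum g S)"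
  by (induction S rule: infinite_finite_induct) (auto intro: skein_eq_refl skein_eq_add)

lemma scale_scale: "scale c (scale c' x) = scale (c * c') x"
  by (rule poly_mapping_eqI) (simp add: lookup_scale mult.assoc)

lemma scale_add_left: "scale (c + c') x = scale c x + scale c' x"
  by (rule poly_mapping_eqI) (simp add: lookup_scale lookup_add distrib_right)

lemma scale_one: "scale 1 x = x"
  by (rule poly_mapping_eqI) (simp add: lookup_scale)

lemma of_nat_mult_scale: "of_nat k * x = scale (of_nat k) x"
proof (induction k)
  case 0
  show ?case by (rule poly_mapping_eqI) (simp add: lookup_scale)
next
  case (Suc k)
  then show ?case by (simp add: distrib_right scale_add_left scale_one)
qed

lemma skein_eq_reduces:
  "reduces t t' \<Longrightarrow> t \<in> tangles a b \<Longrightarrow> skein_eq a b (diag t) (diag t')"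
  using reduces_sound by (simp add: skein_eq_def)

lemma tangles_local:
  assumes "u @ widen l r t @ w \<in> tangles a b" "t \<noteq> []"
    and "\<And>a b. is_tangle a t b \<Longrightarrow> is_tangle a t' b"
  shows "u @ widen l r t' @ w \<in> tangles a b"
  using is_tangle_local assms by (simp add: tangles_def)

lemma skein_eq_curl:
  assumes "t \<in> {curl_right d, curl_left d}" "u @ widen l r t @ w \<in> tangles a b"
  shows "skein_eq a b (diag (u @ widen l r t @ w)) (scale coeff_v_inv (diag (u @ w)))"
proof -
  have "u @ widen l r [] @ w \<in> tangles a b"
    using assms(1) by (intro tangles_local[OF assms(2)]) (auto simp: curl_right_def curl_left_def)
  then show ?thesis
    using skein_relations.kink[OF assms(1) HOL.refl, of u l r w a b] assms(2)
    by (simp add: plug_widen skein_eq_def)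
qed

lemma skein_eq_loop:
  assumes "u @ widen l r (loop d) @ w \<in> tangles a b"
  shows "skein_eq a b (diag (u @ widen l r (loop d) @ w)) (scale coeff_delta (diag (u @ w)))"
proof -
  have "u @ widen l r [] @ w \<in> tangles a b"
    by (intro tangles_local[OF assms]) (auto simp: loop_def)
  then show ?thesis
    using skein_relations.loop[OF HOL.refl, of u l r w d a b] assms
    by (simp add: plug_widen skein_eq_def)
qed

text \<open>
  Changing the upper one of two successive crossings of equal sign lets them cancel.  For two parallel
  strands this is the quadratic relation of the Hecke algebra.
\<close>

lemma skein_eq_double_crossing:
  assumes h: "h = pos_height d e"
    and t: "u @ widen l r [([], Cross h d e, []), ([], Cross h e d, [])] @ w \<in> tangles a b"
  shows "u @ w \<in> tangles a b"
    and "u @ widen l r (([], Cross h d e, []) # smoothing e d) @ w \<in> tangles a b"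
    and "skein_eq a b (diag (u @ widen l r [([], Cross h d e, []), ([], Cross h e d, [])] @ w))
      (diag (u @ w) + scale coeff_z (diag (u @ widen l r (([], Cross h d e, []) # smoothing e d) @ w)))"
proof -
  let ?C = "\<lambda>x. (u @ [(l, Cross h d e, r)]) @ widen l r x @ w"
  have h': "h = pos_height e d"
    using h by (auto simp: pos_height_def)
  have pos: "?C [([], Cross h e d, [])] \<in> tangles a b"
    using t by simp
  have neg: "?C [([], Cross (flip h) e d, [])] \<in> tangles a b"
    by (rule tangles_local[OF pos]) auto
  have smooth: "?C (smoothing e d) \<in> tangles a b"
    by (rule tangles_local[OF pos]) (cases d; cases e; auto simp: smoothing_def)+
  have cancel: "reduces (?C [([], Cross (flip h) e d, [])]) (u @ w)"
    using reduces.move[OF diagram_move.reid2[of h d e], of u l r w] by simp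
  show "u @ w \<in> tangles a b"
    using reduces_sound[OF cancel neg] by blast
  show "u @ widen l r (([], Cross h d e, []) # smoothing e d) @ w \<in> tangles a b"
    using smooth by simp
  have "diag (?C [([], Cross h e d, [])]) - diag (?C [([], Cross (flip h) e d, [])])
      - scale coeff_z (diag (?C (smoothing e d))) \<in> skein_relations a b"
    using skein_relations.skein[OF HOL.refl, of "u @ [(l, Cross h d e, r)]" l r w e d a b]
      pos neg smooth by (simp only: plug_widen h'[symmetric]) simp
  then have "skein_eq a b (diag (?C [([], Cross h e d, [])]))
      (diag (?C [([], Cross (flip h) e d, [])]) + scale coeff_z (diag (?C (smoothing e d))))"
    by (simp add: skein_eq_def algebra_simps)
  also have "skein_eq a b \<dots> (diag (u @ w) + scale coeff_z (diag (?C (smoothing e d))))"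
    by (intro skein_eq_add skein_eq_refl skein_eq_reduces[OF cancel neg])
  finally show "skein_eq a b (diag (u @ widen l r [([], Cross h d e, []), ([], Cross h e d, [])] @ w))
      (diag (u @ w) + scale coeff_z (diag (u @ widen l r (([], Cross h d e, []) # smoothing e d) @ w)))"
    by simp
qed

section \<open>Expansion of the encircling loop\<close>

definition loop_dir :: "height \<Rightarrow> dir" where
  "loop_dir h = (case h of Over \<Rightarrow> Up | Under \<Rightarrow> Down)"

text \<open>
  The loop around the first \<open>m\<close> of \<open>m + p\<close> strings.
\<close>

definition encircling_first :: "height \<Rightarrow> nat \<Rightarrow> nat \<Rightarrow> tangle" where
  "encircling_first h m p =
    [([], Cup (rev_dir (loop_dir h)), ups (m + p))]
    @ widen [rev_dir (loop_dir h)] (ups p) (pass_right h (loop_dir h) m @ pass_left h (loop_dir h) m)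
    @ [([], Cap (rev_dir (loop_dir h)), ups (m + p))]"

lemma encircling_first_all: "encircling_first h n 0 = encircling h n"
proof -
  note rows = widen_pass_right[of 0, simplified] widen_pass_left[of 0, simplified]
  show ?thesis
    unfolding encircling_first_def encircling_def Let_def loop_dir_def[symmetric]
    by (simp add: rows) (simp add: widen_def comp_def)
qed

text \<open>
  String \<open>m + 1\<close> is taken out of the loop: the skein relation at its upper crossing with the loop leaves
  the smaller loop and the merged diagram \<open>k\<close>, which \<open>pull_over\<close> and \<open>pull_under\<close> bring to the form of a
  braid with a curl.
\<close>

lemma encircling_step:
  assumes t: "encircling_first h (Suc m) p \<in> tangles a b"
  shows "encircling_first h m (Suc p) \<in> tangles a b"
    and "skein_eq a b (diag (encircling_first h (Suc m) p))
      (diag (encircling_first h m (Suc p))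
        + scale (coeff_z * coeff_v_inv) (diag (widen [] (ups p) (pass_left Over Up m @ pass_right Over Up m))))"
proof -
  define d where "d = loop_dir h"
  define c where "c = rev_dir d"
  define u where "u = ([], Cup c, ups (Suc m + p)) # widen [c] (Up # ups p) (pass_right h d m)"
  define w where "w = widen [c] (Up # ups p) (pass_left h d m) @ [([], Cap c, ups (Suc m + p))]"
  define k where "k = u @ widen (c # ups m) (ups p) (([], Cross h d Up, []) # smoothing Up d) @ w"
  have h: "h = pos_height d Up"
    by (cases h) (simp_all add: d_def loop_dir_def pos_height_def)
  have E: "encircling_first h (Suc m) p =
      u @ widen (c # ups m) (ups p) [([], Cross h d Up, []), ([], Cross h Up d, [])] @ w"
    by (simp add: encircling_first_def u_def w_def d_def c_def)
  have E': "encircling_first h m (Suc p) = u @ w"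
    by (simp add: encircling_first_def u_def w_def d_def c_def ups_snoc)
  note skein = skein_eq_double_crossing[OF h t[unfolded E], folded k_def, folded E E']
  show "encircling_first h m (Suc p) \<in> tangles a b"
    by (rule skein(1))
  let ?J = "widen [] (ups p) (pass_left Over Up m @ pass_right Over Up m)"
  have "skein_eq a b (diag k) (scale coeff_v_inv (diag ?J))"
  proof (cases h)
    case Over
    let ?t = "widen [] (ups p) (pass_left Over Up m) @ widen [] (ups m @ ups p) (curl_left Up)
      @ widen [] (ups p) (pass_right Over Up m)"
    have red: "reduces k ?t"
      using reduces_context[OF pull_over[of m], of "[]" "[]" "ups p" "[]"] Over
      by (simp add: k_def u_def w_def d_def c_def loop_dir_def smoothing_def replicate_add)
    have typed: "?t \<in> tangles a b"
      using reduces_sound[OF red skein(2)] by blast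
    have "skein_eq a b (diag k) (diag ?t)"
      by (rule skein_eq_reduces[OF red skein(2)])
    also have "skein_eq a b (diag ?t) (scale coeff_v_inv (diag ?J))"
      using skein_eq_curl[OF _ typed, of Up] by simp
    finally show ?thesis .
  next
    case Under
    let ?t = "[] @ widen (ups m) (ups p) (curl_right Up) @ ?J"
    have red: "reduces k ?t"
      using reduces_context[OF pull_under[of m], of "[]" "[]" "ups p" "[]"] Under
      by (simp add: k_def u_def w_def d_def c_def loop_dir_def smoothing_def replicate_add)
    have typed: "?t \<in> tangles a b"
      using reduces_sound[OF red skein(2)] by blast
    have "skein_eq a b (diag k) (diag ?t)"
      by (rule skein_eq_reduces[OF red skein(2)])
    also have "skein_eq a b (diag ?t) (scale coeff_v_inv (diag ?J))"
      using skein_eq_curl[OF _ typed, of Up] by simp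
    finally show ?thesis .
  qed
  from skein_eq_add[OF skein_eq_refl skein_eq_scale[OF this]]
  show "skein_eq a b (diag (encircling_first h (Suc m) p))
      (diag (encircling_first h m (Suc p)) + scale (coeff_z * coeff_v_inv) (diag ?J))"
    using skein(3) by (auto intro: skein_eq_trans simp: scale_scale)
qed

definition braid_word :: "nat \<Rightarrow> nat list \<Rightarrow> tangle" where
  "braid_word n = map (\<lambda>i. (ups (i - 1), pos_cross Up Up, ups (n - i - 1)))"

lemma braid_word_tangle:
  assumes "set is \<subseteq> {1..<n}"
  shows "braid_word n is \<in> tangles (ups n) (ups n)"
  using assms
proof (induction "is")
  case Nil
  show ?case by (simp add: braid_word_def tangles_def)
next
  case (Cons i "is")
  define k m where "k = i - 1" and "m = n - i - 1"
  moreover have "1 \<le> i" "i < n"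
    using Cons.prems by auto
  ultimately have "n = k + (2 + m)"
    by simp
  then have "ups n = ups k @ [Up, Up] @ ups m"
    by (simp add: replicate_add numeral_2_eq_2 replicate_app_Cons_same)
  with Cons show ?case
    by (simp add: braid_word_def tangles_def k_def m_def)
qed

lemma braid_word_pass:
  "widen [] (ups p) (pass_left Over Up m @ pass_right Over Up m) =
     braid_word (Suc m + p) (rev [1..<Suc m] @ [1..<Suc m])"
proof -
  have "[1..<Suc m] = map Suc [0..<m]"
    by (simp add: map_Suc_upt)
  then show ?thesis
    by (simp add: widen_pass_left widen_pass_right braid_word_def pos_height_def rev_map del: upt_Suc)
qed

lemma encircling_first_expansion:
  assumes "encircling_first h m p \<in> tangles a b"
  shows "skein_eq a b (diag (encircling_first h m p))
    (scale coeff_delta (diag []) + (\<Sum>k\<in>{1..m}. scale (coeff_z * coeff_v_inv)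
       (diag (braid_word (m + p) (rev [1..<k] @ [1..<k])))))"
  using assms
proof (induction m arbitrary: p)
  case 0
  have "encircling_first h 0 p = [] @ widen [] (ups p) (loop (rev_dir (loop_dir h))) @ []"
    by (simp add: encircling_first_def loop_def)
  with 0 show ?case
    using skein_eq_loop[of "[]" "[]" "ups p" "rev_dir (loop_dir h)" "[]" a b] by simp
next
  case (Suc m)
  let ?f = "\<lambda>k. scale (coeff_z * coeff_v_inv) (diag (braid_word (Suc m + p) (rev [1..<k] @ [1..<k])))"
  have "skein_eq a b (diag (encircling_first h (Suc m) p))
      (diag (encircling_first h m (Suc p)) + ?f (Suc m))"
    using encircling_step(2)[OF Suc.prems] by (simp only: braid_word_pass)
  also have "skein_eq a b \<dots> ((scale coeff_delta (diag []) + (\<Sum>k\<in>{1..m}. ?f k)) + ?f (Suc m))"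
    using Suc.IH[OF encircling_step(1)[OF Suc.prems]]
    by (intro skein_eq_add skein_eq_refl) simp
  finally show ?case
    by (simp add: add.assoc del: upt_Suc)
qed

text \<open>
  The middle of the word is a square \<open>\<sigma>\<^sub>i\<^sup>2\<close>.  Its expansion leaves the same kind of word starting at
  \<open>i + 1\<close>, and the word with a single \<open>\<sigma>\<^sub>i\<close>, which is the chosen one for \<open>(i k)\<close>.
\<close>

lemma pass_word_expansion:
  assumes "1 \<le> i" "i \<le> k" "k \<le> n"
  shows "skein_eq (ups n) (ups n) (diag (braid_word n (rev [i..<k] @ [i..<k])))
    (diag [] + (\<Sum>j\<in>{i..<k}. scale coeff_z (diag (braid_word n (transposition_word j k)))))"
  using assms(2,1)
proof (induction rule: inc_induct)
  case base
  show ?case by (simp add: braid_word_def skein_eq_refl)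
next
  case (step i)
  let ?u = "braid_word n (rev [Suc i..<k])" and ?w = "braid_word n [Suc i..<k]"
  let ?X = "([], Cross Over Up Up, [])"
  have split: "braid_word n (rev [i..<k] @ [i..<k]) =
      ?u @ widen (ups (i - 1)) (ups (n - i - 1)) [?X, ?X] @ ?w"
    using step by (simp add: braid_word_def pos_height_def upt_conv_Cons)
  have word: "braid_word n (transposition_word i k) =
      ?u @ widen (ups (i - 1)) (ups (n - i - 1)) [?X] @ ?w"
    using step by (simp add: braid_word_def pos_height_def upt_conv_Cons transposition_word_def)
  have "braid_word n (rev [i..<k] @ [i..<k]) \<in> tangles (ups n) (ups n)"
    using step assms by (intro braid_word_tangle) auto
  note skein = skein_eq_double_crossing(3)[OF _ this[unfolded split]]
  have "skein_eq (ups n) (ups n) (diag (braid_word n (rev [i..<k] @ [i..<k])))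
      (diag (braid_word n (rev [Suc i..<k] @ [Suc i..<k]))
        + scale coeff_z (diag (braid_word n (transposition_word i k))))"
    unfolding split word using skein by (simp add: pos_height_def smoothing_def braid_word_def)
  also have "skein_eq (ups n) (ups n) \<dots>
     ((diag [] + (\<Sum>j\<in>{Suc i..<k}. scale coeff_z (diag (braid_word n (transposition_word j k)))))
        + scale coeff_z (diag (braid_word n (transposition_word i k))))"
    using step by (intro skein_eq_add skein_eq_refl) simp
  finally show ?case
    using step by (simp add: sum.atLeast_Suc_lessThan algebra_simps)
qed

definition murphy_diagrams :: "nat \<Rightarrow> tangle \<Rightarrow>\<^sub>0 coeff" where
  "murphy_diagrams n = (\<Sum>j\<in>{2..n}. \<Sum>i\<in>{1..j - 1}. diag (braid_word n (transposition_word i j)))"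

lemma encircling_expansion:
  "skein_eq (ups n) (ups n) (diag (encircling h n))
    (scale (coeff_delta + coeff_z * coeff_v_inv * of_nat n) (diag [])
      + scale (coeff_z * coeff_v_inv * coeff_z) (murphy_diagrams n))"
proof -
  let ?q = "coeff_z * coeff_v_inv" and ?w = "\<lambda>i k. diag (braid_word n (transposition_word i k))"
  have "skein_eq (ups n) (ups n) (diag (encircling h n))
    (scale coeff_delta (diag []) + (\<Sum>k\<in>{1..n}. scale ?q (diag (braid_word n (rev [1..<k] @ [1..<k])))))"
    using encircling_first_expansion[of h n 0] encircling_tangle[of h n]
    by (simp add: encircling_first_all)
  also have "skein_eq (ups n) (ups n) \<dots>
    (scale coeff_delta (diag []) + (\<Sum>k\<in>{1..n}. scale ?q (diag [] + (\<Sum>i\<in>{1..<k}. scale coeff_z (?w i k)))))"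
    by (intro skein_eq_add skein_eq_refl skein_eq_sum skein_eq_scale pass_word_expansion) auto
  also have "(\<Sum>k\<in>{1..n}. scale ?q (diag [] + (\<Sum>i\<in>{1..<k}. scale coeff_z (?w i k)))) =
      scale (?q * of_nat n) (diag []) + scale (?q * coeff_z) (\<Sum>k\<in>{1..n}. \<Sum>i\<in>{1..<k}. ?w i k)"
    by (simp add: scale_add scale_sum sum.distrib of_nat_mult_scale scale_scale mult_ac)
  also have "(\<Sum>k\<in>{1..n}. \<Sum>i\<in>{1..<k}. ?w i k) = murphy_diagrams n"
    unfolding murphy_diagrams_def
    by (intro sum.mono_neutral_cong_right sum.cong) (auto simp: le_Suc_eq)
  finally show ?thesis
    by (simp add: scale_add_left add.assoc)
qed

section \<open>Passage to the Hecke algebra\<close>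

definition skein_class :: "nat \<Rightarrow> (tangle \<Rightarrow>\<^sub>0 coeff) \<Rightarrow> (tangle \<Rightarrow>\<^sub>0 coeff) set" where
  "skein_class n x = hecke_rels n +>\<^bsub>tangle_algebra n\<^esub> x"

lemma skein_class_hom: "skein_class n \<in> ring_hom (tangle_algebra n) (hecke n)"
proof -
  have "(+>\<^bsub>tangle_algebra n\<^esub>) (hecke_rels n) \<in>
      ring_hom (tangle_algebra n) (tangle_algebra n Quot hecke_rels n)"
    by (rule ideal.rcos_ring_hom[OF hecke_rels_ideal])
  then show ?thesis
    by (simp add: skein_class_def[abs_def] hecke_def ring.defs ring_hom_def)
qed

lemma diag_carrier: "t \<in> tangles (ups n) (ups n) \<Longrightarrow> diag t \<in> carrier (tangle_algebra n)"
  by (simp add: tangle_algebra_def)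

lemma scale_carrier: "x \<in> carrier (tangle_algebra n) \<Longrightarrow> scale c x \<in> carrier (tangle_algebra n)"
  by (auto simp: tangle_algebra_def in_keys_iff lookup_scale)

lemma add_carrier:
  "x \<in> carrier (tangle_algebra n) \<Longrightarrow> y \<in> carrier (tangle_algebra n) \<Longrightarrow> x + y \<in> carrier (tangle_algebra n)"
  using keys_add[of x y] by (auto simp: tangle_algebra_def)

lemma sum_carrier:
  "(\<And>i. i \<in> S \<Longrightarrow> f i \<in> carrier (tangle_algebra n)) \<Longrightarrow> sum f S \<in> carrier (tangle_algebra n)"
  by (induction S rule: infinite_finite_induct) (simp_all add: add_carrier, simp_all add: tangle_algebra_def)

lemma skein_class_add:
  "x \<in> carrier (tangle_algebra n) \<Longrightarrow> y \<in> carrier (tangle_algebra n) \<Longrightarrow>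
    skein_class n x \<oplus>\<^bsub>hecke n\<^esub> skein_class n y = skein_class n (x + y)"
  using ring_hom_add[OF skein_class_hom, of x n y] by (simp add: tangle_algebra_def)

lemma skein_class_mult:
  "x \<in> carrier (tangle_algebra n) \<Longrightarrow> y \<in> carrier (tangle_algebra n) \<Longrightarrow>
    skein_class n x \<otimes>\<^bsub>hecke n\<^esub> skein_class n y = skein_class n (x * y)"
  using ring_hom_mult[OF skein_class_hom, of x n y] by (simp add: tangle_algebra_def)

lemma skein_class_one: "\<one>\<^bsub>hecke n\<^esub> = skein_class n (diag [])"
  using ring_hom_one[OF skein_class_hom, of n] by (simp add: tangle_algebra_def flip: zero_list_def)

lemma skein_class_closed:
  "x \<in> carrier (tangle_algebra n) \<Longrightarrow> skein_class n x \<in> carrier (hecke n)"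
  by (rule ring_hom_closed[OF skein_class_hom])

lemma skein_class_zero: "\<zero>\<^bsub>hecke n\<^esub> = skein_class n 0"
  using ring_hom_zero[OF skein_class_hom tangle_algebra_ring hecke_ring, of n]
  by (simp add: tangle_algebra_def)

lemma skein_class_sum:
  assumes "finite S" "\<And>i. i \<in> S \<Longrightarrow> f i \<in> carrier (tangle_algebra n)"
  shows "(\<Oplus>\<^bsub>hecke n\<^esub>i\<in>S. skein_class n (f i)) = skein_class n (sum f S)"
proof -
  interpret ring "hecke n" by (rule hecke_ring)
  show ?thesis
    using assms
  proof (induction S)
    case empty
    then show ?case by (simp add: skein_class_zero)
  next
    case (insert i S)
    then show ?case
      by (simp add: skein_class_closed sum_carrier skein_class_add Pi_def)
  qed
qed

lemma skein_class_eqI: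
  assumes "skein_eq (ups n) (ups n) x y" "x \<in> carrier (tangle_algebra n)" "y \<in> carrier (tangle_algebra n)"
  shows "skein_class n x = skein_class n y"
proof -
  interpret I: ideal "hecke_rels n" "tangle_algebra n" by (rule hecke_rels_ideal)
  have "x = (x - y) \<oplus>\<^bsub>tangle_algebra n\<^esub> y"
    by (simp add: tangle_algebra_def)
  moreover have "x - y \<in> hecke_rels n"
    using assms(1) by (simp add: skein_eq_def hecke_rels_def)
  ultimately have "x \<in> hecke_rels n +>\<^bsub>tangle_algebra n\<^esub> y"
    by (auto simp: a_r_coset_def r_coset_def)
  then show ?thesis
    unfolding skein_class_def using I.a_repr_independence assms(3) I.is_additive_subgroup
    by (metis additive_subgroup.a_subgroup)
qed

lemma sigma_word_class:
  assumes "set is \<subseteq> {1..<n}"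
  shows "foldr (\<lambda>k x. sigma n k \<otimes>\<^bsub>hecke n\<^esub> x) is \<one>\<^bsub>hecke n\<^esub> = skein_class n (diag (braid_word n is))"
  using assms
proof (induction "is")
  case Nil
  show ?case by (simp add: skein_class_one braid_word_def)
next
  case (Cons i "is")
  have "sigma n i = skein_class n (diag (braid_word n [i]))"
    by (simp add: sigma_def tangle_class_def skein_class_def braid_word_def)
  moreover have "braid_word n [i] @ braid_word n is = braid_word n (i # is)"
    by (simp add: braid_word_def)
  ultimately show ?case
    using Cons by (simp add: skein_class_mult diag_carrier braid_word_tangle diag_mult)
qed

lemma transposition_word_set: "1 \<le> i \<Longrightarrow> j \<le> n \<Longrightarrow> set (transposition_word i j) \<subseteq> {1..<n}"
  by (auto simp: transposition_word_def)

lemma murphy_word_carrier: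
  "1 \<le> i \<Longrightarrow> j \<le> n \<Longrightarrow> diag (braid_word n (transposition_word i j)) \<in> carrier (tangle_algebra n)"
  by (intro diag_carrier braid_word_tangle transposition_word_set)

lemma omega_class:
  "1 \<le> i \<Longrightarrow> j \<le> n \<Longrightarrow> omega n i j = skein_class n (diag (braid_word n (transposition_word i j)))"
  unfolding omega_def by (rule sigma_word_class[OF transposition_word_set])

lemma murphy_sum_class: "murphy_sum n = skein_class n (murphy_diagrams n)"
proof -
  interpret ring "hecke n" by (rule hecke_ring)
  have *: "murphy n j = skein_class n (\<Sum>i\<in>{1..j - 1}. diag (braid_word n (transposition_word i j)))"
    if "j \<in> {2..n}" for j
  proof -
    have "murphy n j = (\<Oplus>\<^bsub>hecke n\<^esub>i\<in>{1..j - 1}. skein_class n (diag (braid_word n (transposition_word i j))))"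
      unfolding murphy_def using that
      by (intro finsum_cong') (auto intro!: omega_class skein_class_closed murphy_word_carrier)
    also have "\<dots> = skein_class n (\<Sum>i\<in>{1..j - 1}. diag (braid_word n (transposition_word i j)))"
      using that by (intro skein_class_sum murphy_word_carrier) auto
    finally show ?thesis .
  qed
  have "murphy_sum n = (\<Oplus>\<^bsub>hecke n\<^esub>j\<in>{2..n}.
      skein_class n (\<Sum>i\<in>{1..j - 1}. diag (braid_word n (transposition_word i j))))"
    unfolding murphy_sum_def using *
    by (intro finsum_cong') (auto intro!: skein_class_closed sum_carrier murphy_word_carrier)
  also have "\<dots> = skein_class n (murphy_diagrams n)"
    unfolding murphy_diagrams_def by (intro skein_class_sum sum_carrier murphy_word_carrier) auto
  finally show ?thesis .
qed

theorem theorem2p2: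
  fixes n :: nat and h :: height
  assumes "n \<ge> 1"
  shows "\<exists>\<alpha> \<beta> :: coeff. murphy_sum n =
    \<alpha> \<odot>\<^bsub>hecke n\<^esub> tangle_class n (encircling h n) \<oplus>\<^bsub>hecke n\<^esub> \<beta> \<odot>\<^bsub>hecke n\<^esub> \<one>\<^bsub>hecke n\<^esub>"
proof -
  define \<gamma> where "\<gamma> = coeff_delta + coeff_z * coeff_v_inv * of_nat n"
  \<comment> \<open>the coefficients solve \<open>T = \<gamma> \<cdot> 1 + z\<^sup>2 v\<^sup>-\<^sup>1 M\<close> for \<open>M\<close>\<close>
  define \<alpha> where "\<alpha> = coeff_v * (coeff_z_inv * coeff_z_inv)"
  define \<beta> where "\<beta> = - (\<alpha> * \<gamma>)"
  let ?T = "diag (encircling h n)" and ?M = "murphy_diagrams n" and ?I = "diag [] :: tangle \<Rightarrow>\<^sub>0 coeff"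
  have unit: "\<alpha> * (coeff_z * coeff_v_inv * coeff_z) = 1"
  proof -
    have "\<alpha> * (coeff_z * coeff_v_inv * coeff_z) =
        (coeff_v * coeff_v_inv) * ((coeff_z * coeff_z_inv) * (coeff_z * coeff_z_inv))"
      by (simp add: \<alpha>_def mult_ac)
    then show ?thesis by (simp add: coeff_v_unit coeff_z_unit)
  qed
  have T: "?T \<in> carrier (tangle_algebra n)" and one: "?I \<in> carrier (tangle_algebra n)"
    by (auto intro!: diag_carrier encircling_tangle simp: tangles_def)
  have M: "?M \<in> carrier (tangle_algebra n)"
    unfolding murphy_diagrams_def by (intro sum_carrier murphy_word_carrier) auto
  have "skein_eq (ups n) (ups n) (scale \<alpha> ?T + scale \<beta> ?I)
      (scale \<alpha> (scale \<gamma> ?I + scale (coeff_z * coeff_v_inv * coeff_z) ?M) + scale \<beta> ?I)"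
    unfolding \<gamma>_def by (intro skein_eq_add skein_eq_refl skein_eq_scale encircling_expansion)
  also have "scale \<alpha> (scale \<gamma> ?I + scale (coeff_z * coeff_v_inv * coeff_z) ?M) + scale \<beta> ?I =
      scale (\<alpha> * \<gamma> + \<beta>) ?I + ?M"
    by (simp add: scale_add scale_scale unit scale_one scale_add_left add_ac)
  also have "\<dots> = ?M"
    by (rule poly_mapping_eqI) (simp add: \<beta>_def lookup_scale lookup_add)
  finally have "skein_class n (scale \<alpha> ?T + scale \<beta> ?I) = skein_class n ?M"
    by (rule skein_class_eqI) (intro add_carrier scale_carrier T one M)+
  then have "murphy_sum n = skein_class n (scale \<alpha> ?T) \<oplus>\<^bsub>hecke n\<^esub> skein_class n (scale \<beta> ?I)"
    by (simp add: murphy_sum_class skein_class_add scale_carrier T one)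
  also have "\<dots> = \<alpha> \<odot>\<^bsub>hecke n\<^esub> tangle_class n (encircling h n) \<oplus>\<^bsub>hecke n\<^esub> \<beta> \<odot>\<^bsub>hecke n\<^esub> \<one>\<^bsub>hecke n\<^esub>"
    using hecke_smult[OF T, of \<alpha>] hecke_smult[OF one, of \<beta>]
    by (simp add: skein_class_one tangle_class_def skein_class_def)
  finally show ?thesis by blast
qed

end
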